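(* Let $\Omega$ be a bounded domain in $\mathbb{C}^n$, $n\ge 2$. Let $K$ be a compact subset of $\Omega$ such that $\Omega\setminus K$ is connected. Write $D:=\Omega\setminus K$. Then $$s_D(z)\le\tanh\big(K_\Omega(z;\partial D\cap K)\big)\quad\text{for all }z\in D.$$
   Context: $B^n(a,r)$ denotes the open Euclidean ball in $\mathbb{C}^n$ with centre $a$ and radius $r$. Squeezing function: for a bounded domain $D\subset\mathbb{C}^n$ and $z\in D$, $$s_D(z):=\sup\{s_D(z;F)\mid F:D\to B^n(0,1)\text{ is a holomorphic embedding with }F(z)=0\},$$ where $s_D(z;F):=\sup\{r>0: B^n(0,r)\subset F(D)\}$. $K_\Omega$ denotes the Kobayashi pseudodistance on $\Omega$, normalized so that $K_{B^n(0,1)}(0,z)=\tanh^{-1}\|z\|$; for a set $S\subset\Omega$, $K_\Omega(z;S):=\inf_{x\in S}K_\Omega(z,x)$. *)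

theory Defs
  imports "HOL-Complex_Analysis.Complex_Analysis"
begin

text \<open>
  Points of \<open>n\<close>-dimensional complex space are vectors of type \<open>complex ^ 'n\<close> with
  \<open>n = CARD('n)\<close>. The library norm on this type is the Euclidean one, so \<open>ball a r\<close> is the
  open Euclidean ball. Multiplication by complex scalars is \<open>*s\<close>.
\<close>

definition holomorphic_map_on ::
    "(complex ^ 'n \<Rightarrow> complex ^ 'm) \<Rightarrow> (complex ^ 'n) set \<Rightarrow> bool" where
  "holomorphic_map_on F D \<longleftrightarrow>
     (\<forall>z\<in>D. \<exists>F'. (F has_derivative F') (at z within D) \<and> Vector_Spaces.linear (*s) (*s) F')"

text \<open>
  An embedding is an injective immersion that is a homeomorphism onto its image. On open sets
  the derivative is unique, so the second condition below speaks about the derivative of \<open>F\<close>.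
  Injectivity is part of \<open>homeomorphism\<close>.
\<close>

definition holomorphic_embedding_on ::
    "(complex ^ 'n \<Rightarrow> complex ^ 'm) \<Rightarrow> (complex ^ 'n) set \<Rightarrow> bool" where
  "holomorphic_embedding_on F D \<longleftrightarrow>
     holomorphic_map_on F D \<and>
     (\<forall>z\<in>D. \<exists>F'. (F has_derivative F') (at z within D) \<and> inj F') \<and>
     (\<exists>G. homeomorphism D (F ` D) F G)"

text \<open>
  Both suprema below are taken in the reals. For a bounded domain \<open>D\<close>, a point \<open>z\<close> of \<open>D\<close> and an
  admissible \<open>F\<close>, the sets are nonempty (\<open>F ` D\<close> is an open neighbourhood of \<open>0\<close>, and an affine
  map \<open>w \<mapsto> c (w - z)\<close> with small \<open>c > 0\<close> is admissible) and bounded above by \<open>1\<close>.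
\<close>

definition squeezing_radius ::
    "(complex ^ 'n) set \<Rightarrow> (complex ^ 'n \<Rightarrow> complex ^ 'n) \<Rightarrow> real" where
  "squeezing_radius D F = Sup {r. r > 0 \<and> ball 0 r \<subseteq> F ` D}"

definition squeezing_function :: "(complex ^ 'n) set \<Rightarrow> complex ^ 'n \<Rightarrow> real" where
  "squeezing_function D z =
     Sup {squeezing_radius D F | F.
            holomorphic_embedding_on F D \<and> F ` D \<subseteq> ball 0 1 \<and> F z = 0}"

definition analytic_disc_in :: "(complex \<Rightarrow> complex ^ 'n) \<Rightarrow> (complex ^ 'n) set \<Rightarrow> bool" where
  "analytic_disc_in f \<Omega> \<longleftrightarrow>
     (\<forall>i. (\<lambda>\<zeta>. f \<zeta> $ i) holomorphic_on ball 0 1) \<and> f ` ball 0 1 \<subseteq> \<Omega>"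

text \<open>
  The normalization of the Poincare distance, \<open>poincare_dist 0 \<zeta> = artanh (cmod \<zeta>)\<close>, is the one
  for which the Kobayashi distance from \<open>0\<close> to \<open>z\<close> in the unit ball is \<open>artanh (norm z)\<close>.
\<close>

definition poincare_dist :: "complex \<Rightarrow> complex \<Rightarrow> real" where
  "poincare_dist a b = artanh (cmod (a - b) / cmod (1 - cnj a * b))"

definition kobayashi_chain ::
    "(complex ^ 'n) set \<Rightarrow> complex ^ 'n \<Rightarrow> complex ^ 'n \<Rightarrow> nat \<Rightarrow>
     (nat \<Rightarrow> complex \<Rightarrow> complex ^ 'n) \<Rightarrow> (nat \<Rightarrow> complex) \<Rightarrow> (nat \<Rightarrow> complex) \<Rightarrow> bool" where
  "kobayashi_chain \<Omega> z w m f a b \<longleftrightarrow>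
     m \<ge> 1 \<and>
     (\<forall>j<m. analytic_disc_in (f j) \<Omega> \<and> a j \<in> ball 0 1 \<and> b j \<in> ball 0 1) \<and>
     f 0 (a 0) = z \<and>
     (\<forall>j. Suc j < m \<longrightarrow> f j (b j) = f (Suc j) (a (Suc j))) \<and>
     f (m - 1) (b (m - 1)) = w"

text \<open>
  The infima are taken in the extended reals, so that the distance to the empty set is \<open>\<infinity>\<close>.
\<close>

definition kobayashi_dist ::
    "(complex ^ 'n) set \<Rightarrow> complex ^ 'n \<Rightarrow> complex ^ 'n \<Rightarrow> ereal" where
  "kobayashi_dist \<Omega> z w =
     Inf {ereal (\<Sum>j<m. poincare_dist (a j) (b j)) | m f a b. kobayashi_chain \<Omega> z w m f a b}"

definition kobayashi_setdist ::
    "(complex ^ 'n) set \<Rightarrow> complex ^ 'n \<Rightarrow> (complex ^ 'n) set \<Rightarrow> ereal" where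
  "kobayashi_setdist \<Omega> z S = (INF x\<in>S. kobayashi_dist \<Omega> z x)"

text \<open>The continuous extension of \<open>tanh\<close> to the extended reals.\<close>

definition tanh_ereal :: "ereal \<Rightarrow> ereal" where
  "tanh_ereal x = (case x of ereal r \<Rightarrow> ereal (tanh r) | PInfty \<Rightarrow> 1 | MInfty \<Rightarrow> -1)"

end

theory Submission
  imports Defs
begin

text \<open>
Write \<open>D = \<Omega> - K\<close>, and let \<open>F\<close> be an admissible embedding of \<open>D\<close> into the unit ball with
\<open>F z = 0\<close> and \<open>ball 0 r \<subseteq> F ` D\<close>. Since \<open>n \<ge> 2\<close>, the components of \<open>F\<close> extend holomorphically across
the compact set \<open>K\<close> (\<open>hartogs_extension\<close>), and by the maximum principle the extended map \<open>E\<close> sends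
\<open>\<Omega>\<close> into the closed unit ball. Let \<open>x\<close> be a point of \<open>K\<close> on the boundary of \<open>D\<close>. Then \<open>E x\<close> lies
outside \<open>F ` D\<close>: otherwise \<open>E x = F y\<close> with \<open>y \<in> D\<close>, and the continuous inverse of \<open>F\<close> would carry
points of \<open>D\<close> tending to \<open>x\<close> to points tending to \<open>y\<close>, so \<open>x = y \<in> D\<close>
(\<open>embedding_limit_avoids_image\<close>). In particular \<open>norm (E x) \<ge> r\<close>. On the other hand, projecting \<open>E\<close>
orthogonally to the line through \<open>E x\<close> gives a scalar function that vanishes at \<open>z\<close>, is bounded by
\<open>1\<close> and has modulus \<open>norm (E x)\<close> at \<open>x\<close>. The Schwarz-Pick lemma along the discs of a Kobayashi chain
from \<open>z\<close> to \<open>x\<close> bounds this modulus by the hyperbolic tangent of the length of the chain. Hence \<open>r\<close>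
is at most that number, for every chain, every \<open>x\<close> and every \<open>F\<close>.

The extension theorem is proved by slicing. Fix a coordinate \<open>i\<close> and let the point vary along that
coordinate only: on each such complex line, \<open>\<Omega>\<close> and \<open>K\<close> cut out an open planar set \<open>U\<close> and a compact
set \<open>C\<close>, and the restriction of \<open>f\<close> to \<open>U - C\<close> splits uniquely as a function holomorphic on \<open>U\<close> plus
one holomorphic off \<open>C\<close> and vanishing at infinity. Uniqueness is Liouville's theorem; existence comes
from Cauchy integrals over the boundary of a finite union of grid squares around \<open>C\<close>. The first
summand depends holomorphically on the line as well, because the same squares serve for all nearby
lines and, by uniqueness, the choice of squares does not matter. So these first summands form a
holomorphic function on \<open>\<Omega>\<close>. It coincides with \<open>f\<close> on every line that misses \<open>K\<close>; such lines pass
through an open part of \<open>\<Omega> - K\<close> near a point of \<open>K\<close> where the real part of another coordinate is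
maximal. Connectedness of \<open>\<Omega> - K\<close> and the identity theorem give equality on all of \<open>\<Omega> - K\<close>.
\<close>

(* The dollar sign is kept for vector components only. *)
no_notation fps_nth (infixl "$" 75)

section \<open>Holomorphy tested along discs\<close>

text \<open>
Holomorphy of a function of several variables, encoded as continuity together with holomorphy along
every holomorphic map from a planar open set. The encoding fits both uses made of it: it restricts
at once to coordinate lines and to the discs of a Kobayashi chain, and it passes to parameter
integrals without any partial derivatives.
\<close>

definition disc_holomorphic :: "(complex ^ 'n \<Rightarrow> complex) \<Rightarrow> (complex ^ 'n) set \<Rightarrow> bool" where
  "disc_holomorphic f W \<longleftrightarrow>
     continuous_on W f \<and>
     (\<forall>V \<phi>. open V \<longrightarrow> (\<forall>k. (\<lambda>t. \<phi> t $ k) holomorphic_on V) \<longrightarrow> \<phi> ` V \<subseteq> W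
        \<longrightarrow> (\<lambda>t. f (\<phi> t)) holomorphic_on V)"

lemma disc_holomorphicD:
  assumes "disc_holomorphic f W" "open V" "\<And>k. (\<lambda>t. \<phi> t $ k) holomorphic_on V"
    and "\<And>t. t \<in> V \<Longrightarrow> \<phi> t \<in> W"
  shows "(\<lambda>t. f (\<phi> t)) holomorphic_on V"
  using assms unfolding disc_holomorphic_def by blast

lemma disc_holomorphic_imp_continuous_on: "disc_holomorphic f W \<Longrightarrow> continuous_on W f"
  by (simp add: disc_holomorphic_def)

lemma continuous_on_vec_components:
  fixes \<phi> :: "'a::topological_space \<Rightarrow> complex ^ 'n"
  assumes "\<And>k. continuous_on V (\<lambda>t. \<phi> t $ k)"
  shows "continuous_on V \<phi>"
  using continuous_on_vec_lambda[of V "\<lambda>k t. \<phi> t $ k", OF assms] by simp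

lemma disc_holomorphic_subset:
  "disc_holomorphic f W \<Longrightarrow> W' \<subseteq> W \<Longrightarrow> disc_holomorphic f W'"
  unfolding disc_holomorphic_def using continuous_on_subset by blast

lemma disc_holomorphic_cong:
  assumes "disc_holomorphic f W" "\<And>z. z \<in> W \<Longrightarrow> g z = f z"
  shows "disc_holomorphic g W"
  unfolding disc_holomorphic_def
proof (intro conjI allI impI)
  show "continuous_on W g"
    using disc_holomorphic_imp_continuous_on[OF assms(1)] assms(2) by (simp cong: continuous_on_cong)
  fix V \<phi> assume V: "open V" "\<forall>k. (\<lambda>t. \<phi> t $ k) holomorphic_on V" "\<phi> ` V \<subseteq> W"
  have "(\<lambda>t. f (\<phi> t)) holomorphic_on V"
    using disc_holomorphicD[OF assms(1)] V by blast
  then show "(\<lambda>t. g (\<phi> t)) holomorphic_on V"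
    by (rule holomorphic_transform) (use V assms(2) in auto)
qed

lemma disc_holomorphic_const: "disc_holomorphic (\<lambda>z. c) W"
  by (auto simp: disc_holomorphic_def)

lemma disc_holomorphic_component: "disc_holomorphic (\<lambda>z. z $ i) W"
  by (auto simp: disc_holomorphic_def intro!: continuous_intros)

lemma disc_holomorphic_add:
  "disc_holomorphic f W \<Longrightarrow> disc_holomorphic g W \<Longrightarrow> disc_holomorphic (\<lambda>z. f z + g z) W"
  by (auto simp: disc_holomorphic_def intro!: continuous_intros holomorphic_intros)

lemma disc_holomorphic_diff:
  "disc_holomorphic f W \<Longrightarrow> disc_holomorphic g W \<Longrightarrow> disc_holomorphic (\<lambda>z. f z - g z) W"
  by (auto simp: disc_holomorphic_def intro!: continuous_intros holomorphic_intros)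

lemma disc_holomorphic_mult:
  "disc_holomorphic f W \<Longrightarrow> disc_holomorphic g W \<Longrightarrow> disc_holomorphic (\<lambda>z. f z * g z) W"
  by (auto simp: disc_holomorphic_def intro!: continuous_intros holomorphic_intros)

lemma disc_holomorphic_divide:
  assumes "disc_holomorphic f W" "disc_holomorphic g W" "\<And>z. z \<in> W \<Longrightarrow> g z \<noteq> 0"
  shows "disc_holomorphic (\<lambda>z. f z / g z) W"
  unfolding disc_holomorphic_def
proof (intro conjI allI impI)
  show "continuous_on W (\<lambda>z. f z / g z)"
    using assms by (auto simp: disc_holomorphic_def intro!: continuous_intros)
  fix V and \<phi> :: "complex \<Rightarrow> complex ^ 'a"
  assume V: "open V" "\<forall>k. (\<lambda>t. \<phi> t $ k) holomorphic_on V" "\<phi> ` V \<subseteq> W"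
  have "(\<lambda>t. f (\<phi> t)) holomorphic_on V" "(\<lambda>t. g (\<phi> t)) holomorphic_on V"
    using disc_holomorphicD[OF assms(1)] disc_holomorphicD[OF assms(2)] V by blast+
  then show "(\<lambda>t. f (\<phi> t) / g (\<phi> t)) holomorphic_on V"
    using V(3) assms(3) by (intro holomorphic_intros) auto
qed

lemma disc_holomorphic_sum:
  "(\<And>a. a \<in> A \<Longrightarrow> disc_holomorphic (f a) W) \<Longrightarrow> disc_holomorphic (\<lambda>z. \<Sum>a\<in>A. f a z) W"
  by (induction A rule: infinite_finite_induct)
     (auto simp: disc_holomorphic_const intro!: disc_holomorphic_add)

lemma disc_holomorphic_locally:
  fixes W :: "(complex ^ 'n) set"
  assumes "\<And>z. z \<in> W \<Longrightarrow> \<exists>N. open N \<and> z \<in> N \<and> disc_holomorphic f (N \<inter> W)"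
  shows "disc_holomorphic f W"
  unfolding disc_holomorphic_def
proof (intro conjI allI impI)
  obtain N where N: "\<And>z. z \<in> W \<Longrightarrow> open (N z) \<and> z \<in> N z \<and> disc_holomorphic f (N z \<inter> W)"
    using assms by metis
  show "continuous_on W f"
    unfolding continuous_on_eq_continuous_within
  proof
    fix z assume z: "z \<in> W"
    have "continuous (at z within N z \<inter> W) f"
      using N[OF z] z disc_holomorphic_imp_continuous_on[of f "N z \<inter> W"]
      by (simp add: continuous_on_eq_continuous_within)
    moreover have "at z within N z \<inter> W = at z within W"
      by (rule at_within_nhd[of _ "N z"]) (use N[OF z] in auto)
    ultimately show "continuous (at z within W) f" by simp
  qed
  fix V and \<phi> :: "complex \<Rightarrow> complex ^ 'n"
  assume V: "open V" "\<forall>k. (\<lambda>t. \<phi> t $ k) holomorphic_on V" "\<phi> ` V \<subseteq> W"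
  have cont: "continuous_on V \<phi>"
    by (rule continuous_on_vec_components) (use V holomorphic_on_imp_continuous_on in blast)
  have op: "open (V \<inter> \<phi> -` N z)" if "z \<in> W" for z
    using continuous_open_preimage[OF cont V(1)] N that by blast
  have "(\<lambda>t. f (\<phi> t)) holomorphic_on (\<Union>z\<in>W. V \<inter> \<phi> -` N z)"
  proof (rule holomorphic_on_UN_open)
    fix z assume z: "z \<in> W"
    show "open (V \<inter> \<phi> -` N z)" using op z by blast
    show "(\<lambda>t. f (\<phi> t)) holomorphic_on (V \<inter> \<phi> -` N z)"
    proof (rule disc_holomorphicD)
      show "disc_holomorphic f (N z \<inter> W)" using N z by blast
      show "open (V \<inter> \<phi> -` N z)" using op z by blast
      show "(\<lambda>t. \<phi> t $ k) holomorphic_on (V \<inter> \<phi> -` N z)" for k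
        using V(2) holomorphic_on_subset by blast
    qed (use V in auto)
  qed
  moreover have "(\<Union>z\<in>W. V \<inter> \<phi> -` N z) = V" using V N by fastforce
  ultimately show "(\<lambda>t. f (\<phi> t)) holomorphic_on V" by simp
qed

lemma disc_holomorphic_Un_open:
  assumes "open A" "open B" "disc_holomorphic f A" "disc_holomorphic f B"
  shows "disc_holomorphic f (A \<union> B)"
proof (rule disc_holomorphic_locally)
  fix z assume "z \<in> A \<union> B"
  then show "\<exists>N. open N \<and> z \<in> N \<and> disc_holomorphic f (N \<inter> (A \<union> B))"
    using assms by (metis Int_absorb2 Un_iff Un_upper1 Un_upper2)
qed

text \<open>
The interior of the zero set is relatively closed: a ball around one of its limit points in \<open>W\<close>
contains a point \<open>q\<close> of that interior, and along the complex line from \<open>q\<close> to any other point of the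
ball the function vanishes near \<open>q\<close>, hence everywhere by the one-variable identity theorem (the line
meets the ball in a convex set).
\<close>

lemma disc_holomorphic_identity:
  fixes W :: "(complex ^ 'n) set"
  assumes f: "disc_holomorphic f W" and W: "open W" "connected W"
    and A: "open A" "A \<noteq> {}" "A \<subseteq> W" "\<And>z. z \<in> A \<Longrightarrow> f z = 0" and "z \<in> W"
  shows "f z = 0"
proof -
  \<comment> \<open>the set on which \<open>f\<close> vanishes together with all its derivatives\<close>
  define Z where "Z = interior {z \<in> W. f z = 0}"
  have nb: "p \<in> Z" if p: "p \<in> W" "p \<in> closure Z" for p
  proof -
    obtain r where r: "r > 0" "ball p r \<subseteq> W" using W(1) p(1) open_contains_ball by blast
    obtain q where q: "q \<in> Z" "q \<in> ball p r"
      using p(2) r(1) by (metis closure_approachable dist_commute mem_ball)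
    obtain e where e: "e > 0" "ball q e \<subseteq> {z \<in> W. f z = 0}"
      using q(1) unfolding Z_def mem_interior by blast
    have "f y = 0" if y: "y \<in> ball p r" for y
    proof -
      define \<phi> where "\<phi> = (\<lambda>t::complex. q + t *s (y - q))"
      have hol: "(\<lambda>t. \<phi> t $ k) holomorphic_on UNIV" for k
        by (auto simp: \<phi>_def intro!: holomorphic_intros)
      then have cont: "continuous_on UNIV \<phi>"
        by (intro continuous_on_vec_components) (use holomorphic_on_imp_continuous_on in blast)
      define V where "V = \<phi> -` ball p r"
      have "open V" unfolding V_def by (rule open_vimage) (use cont in auto)
      have lin: "\<phi> (u *\<^sub>R s + v *\<^sub>R t) = u *\<^sub>R \<phi> s + v *\<^sub>R \<phi> t" if "u + v = 1" for u v s t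
      proof -
        have "u *\<^sub>R \<phi> s + v *\<^sub>R \<phi> t = (u + v) *\<^sub>R q + (u *\<^sub>R s + v *\<^sub>R t) *s (y - q)"
          by (simp add: \<phi>_def vec_eq_iff algebra_simps scaleR_conv_of_real[where 'a = complex])
        then show ?thesis using that by (simp add: \<phi>_def)
      qed
      have "convex V"
      proof (rule convexI)
        fix s t and u v :: real assume *: "s \<in> V" "t \<in> V" "0 \<le> u" "0 \<le> v" "u + v = 1"
        then have "u *\<^sub>R \<phi> s + v *\<^sub>R \<phi> t \<in> ball p r"
          unfolding V_def vimage_def mem_Collect_eq by (intro convexD[OF convex_ball])
        then show "u *\<^sub>R s + v *\<^sub>R t \<in> V" using lin[OF *(5)] by (simp add: V_def)
      qed
      define V0 where "V0 = \<phi> -` (ball p r \<inter> ball q e)"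
      have "open V0" unfolding V0_def by (rule open_vimage) (use cont in auto)
      have 0: "0 \<in> V0" using q(2) e(1) by (simp add: V0_def \<phi>_def)
      have "(\<lambda>t. f (\<phi> t)) holomorphic_on V"
      proof (rule disc_holomorphicD[OF f \<open>open V\<close>])
        show "(\<lambda>t. \<phi> t $ k) holomorphic_on V" for k
          using hol holomorphic_on_subset by blast
      qed (use r V_def in auto)
      moreover have "f (\<phi> t) = 0" if "t \<in> V0" for t
        using that e(2) unfolding V0_def by blast
      moreover have "1 \<in> V" using y by (simp add: V_def \<phi>_def)
      moreover have "V0 \<subseteq> V" by (auto simp: V_def V0_def)
      moreover have "V0 \<noteq> {}" using 0 by blast
      ultimately have "f (\<phi> 1) = 0"
        by (intro analytic_continuation_open[of V0 V "\<lambda>t. f (\<phi> t)" "\<lambda>_. 0" 1]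
              \<open>open V0\<close> \<open>open V\<close> convex_connected[OF \<open>convex V\<close>] holomorphic_on_const) assumption+
      then show ?thesis by (simp add: \<phi>_def)
    qed
    then have "ball p r \<subseteq> {z \<in> W. f z = 0}" using r(2) by blast
    then show ?thesis using r(1) unfolding Z_def mem_interior by blast
  qed
  have "openin (top_of_set W) Z"
    unfolding Z_def by (rule open_subset) (use interior_subset in blast, simp)
  moreover have "closedin (top_of_set W) Z"
  proof -
    have "Z \<subseteq> W" unfolding Z_def using interior_subset by blast
    then have "Z = W \<inter> closure Z"
      using nb closure_subset[of Z] by blast
    then show ?thesis using closedin_closed by blast
  qed
  moreover have "Z \<noteq> {}"
  proof -
    have "A \<subseteq> Z" unfolding Z_def using A by (intro interior_maximal) auto
    then show ?thesis using A by auto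
  qed
  ultimately have "Z = W" using W(2) connected_clopen by blast
  then show ?thesis using \<open>z \<in> W\<close> interior_subset unfolding Z_def by blast
qed

section \<open>Contour integrals depending on a parameter\<close>

lemma continuous_on_linepath_param:
  fixes G :: "'a::topological_space \<Rightarrow> complex \<Rightarrow> complex"
  assumes "continuous_on (W \<times> closed_segment p q) (\<lambda>(z, \<zeta>). G z \<zeta>)"
  shows "continuous_on W (\<lambda>z. contour_integral (linepath p q) (G z))"
proof -
  have "continuous_on (W \<times> cbox 0 1) (\<lambda>(z, x). (case (z, linepath p q x) of (z, \<zeta>) \<Rightarrow> G z \<zeta>))"
    unfolding split_beta
    by (rule continuous_on_compose2[OF assms, unfolded split_beta])
       (auto intro!: continuous_intros simp: linepath_in_path linepath_def[of p q, abs_def] closed_segment_def)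
  then have "continuous_on (W \<times> cbox 0 1) (\<lambda>(z, x). G z (linepath p q x) * (q - p))"
    by (auto simp: split_beta intro!: continuous_intros)
  from integral_continuous_on_param[OF this]
  show ?thesis unfolding contour_integral_integral by simp
qed

text \<open>
Morera's theorem: the integral over a triangle in the parameter can be interchanged with the
integral over the segment, and the inner integral over the triangle is then zero by Cauchy's theorem.
\<close>

lemma holomorphic_on_linepath_param:
  assumes V: "open V" and cont: "continuous_on (V \<times> closed_segment p q) (\<lambda>(t, \<zeta>). G t \<zeta>)"
    and hol: "\<And>\<zeta>. \<zeta> \<in> closed_segment p q \<Longrightarrow> (\<lambda>t. G t \<zeta>) holomorphic_on V"
  shows "(\<lambda>t. contour_integral (linepath p q) (G t)) holomorphic_on V"
proof (rule analytic_imp_holomorphic, rule Morera_triangle)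
  show "continuous_on V (\<lambda>t. contour_integral (linepath p q) (G t))"
    by (rule continuous_on_linepath_param[OF cont])
  show "open V" by fact
  fix a b c
  show "convex hull {a, b, c} \<subseteq> V \<longrightarrow>
       contour_integral (linepath a b) (\<lambda>t. contour_integral (linepath p q) (G t)) +
       contour_integral (linepath b c) (\<lambda>t. contour_integral (linepath p q) (G t)) +
       contour_integral (linepath c a) (\<lambda>t. contour_integral (linepath p q) (G t)) = 0"
  proof
    assume sub: "convex hull {a, b, c} \<subseteq> V"
    let ?J = "\<lambda>a b \<zeta>. contour_integral (linepath a b) (\<lambda>t. G t \<zeta>)"
    have segs: "closed_segment a b \<subseteq> V" "closed_segment b c \<subseteq> V" "closed_segment c a \<subseteq> V"
      using sub by (auto simp: segment_convex_hull) (meson hull_mono insert_mono subset_eq insert_subset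
         subset_insertI empty_subsetI insert_commute)+
    have swap: "contour_integral (linepath x y) (\<lambda>t. contour_integral (linepath p q) (G t)) =
                contour_integral (linepath p q) (?J x y)"
      and int: "?J x y contour_integrable_on linepath p q"
      if "closed_segment x y \<subseteq> V" for x y
    proof -
      show "contour_integral (linepath x y) (\<lambda>t. contour_integral (linepath p q) (G t)) =
                contour_integral (linepath p q) (?J x y)"
        by (rule contour_integral_swap)
           (use that in \<open>auto intro!: continuous_on_subset[OF cont]\<close>)
      have "continuous_on (closed_segment p q \<times> closed_segment x y) (\<lambda>(\<zeta>, t). G t \<zeta>)"
        unfolding split_beta
        by (rule continuous_on_compose2[OF cont, unfolded split_beta, where f = "\<lambda>(x, y). (y, x)",
              unfolded split_beta fst_conv snd_conv])
           (use that in \<open>auto intro!: continuous_intros\<close>)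
      then show "?J x y contour_integrable_on linepath p q"
        by (intro contour_integrable_continuous_linepath continuous_on_linepath_param)
    qed
    have tri: "?J a b \<zeta> + ?J b c \<zeta> + ?J c a \<zeta> = 0" if "\<zeta> \<in> closed_segment p q" for \<zeta>
    proof -
      have h: "(\<lambda>t. G t \<zeta>) holomorphic_on convex hull {a, b, c}"
        using hol[OF that] sub holomorphic_on_subset by blast
      have "(\<lambda>t. G t \<zeta>) contour_integrable_on linepath x y" if "closed_segment x y \<subseteq> V" for x y
        using hol[OF \<open>\<zeta> \<in> _\<close>] that
        by (meson contour_integrable_continuous_linepath holomorphic_on_imp_continuous_on
            holomorphic_on_subset)
      then show ?thesis
        using contour_integral_unique[OF Cauchy_theorem_triangle[OF h]] segs
        by (simp add: contour_integrable_join add.assoc)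
    qed
    have "contour_integral (linepath p q) (\<lambda>\<zeta>. ?J a b \<zeta> + ?J b c \<zeta> + ?J c a \<zeta>) = 0"
      using contour_integral_eq[of "linepath p q" "\<lambda>\<zeta>. ?J a b \<zeta> + ?J b c \<zeta> + ?J c a \<zeta>" "\<lambda>_. 0"] tri
      by simp
    then show "contour_integral (linepath a b) (\<lambda>t. contour_integral (linepath p q) (G t)) +
       contour_integral (linepath b c) (\<lambda>t. contour_integral (linepath p q) (G t)) +
       contour_integral (linepath c a) (\<lambda>t. contour_integral (linepath p q) (G t)) = 0"
      using int segs by (simp add: swap contour_integral_add contour_integrable_add)
  qed
qed

lemma disc_holomorphic_linepath_param:
  fixes W :: "(complex ^ 'n) set"
  assumes cont: "continuous_on (W \<times> closed_segment p q) (\<lambda>(z, \<zeta>). G z \<zeta>)"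
    and hol: "\<And>\<zeta>. \<zeta> \<in> closed_segment p q \<Longrightarrow> disc_holomorphic (\<lambda>z. G z \<zeta>) W"
  shows "disc_holomorphic (\<lambda>z. contour_integral (linepath p q) (G z)) W"
  unfolding disc_holomorphic_def
proof (intro conjI allI impI)
  show "continuous_on W (\<lambda>z. contour_integral (linepath p q) (G z))"
    by (rule continuous_on_linepath_param[OF cont])
  fix V and \<phi> :: "complex \<Rightarrow> complex ^ 'n"
  assume V: "open V" "\<forall>k. (\<lambda>t. \<phi> t $ k) holomorphic_on V" "\<phi> ` V \<subseteq> W"
  have \<phi>: "continuous_on V \<phi>"
    by (rule continuous_on_vec_components) (use V holomorphic_on_imp_continuous_on in blast)
  show "(\<lambda>t. contour_integral (linepath p q) (G (\<phi> t))) holomorphic_on V"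
  proof (rule holomorphic_on_linepath_param[OF V(1)])
    show "continuous_on (V \<times> closed_segment p q) (\<lambda>(t, \<zeta>). G (\<phi> t) \<zeta>)"
      unfolding split_beta
      by (rule continuous_on_compose2[OF cont, unfolded split_beta, where f = "\<lambda>(t, \<zeta>). (\<phi> t, \<zeta>)",
            unfolded split_beta fst_conv snd_conv])
         (use V(3) in \<open>auto intro!: continuous_intros continuous_on_compose2[OF \<phi>]\<close>)
  qed (use disc_holomorphicD[OF hol] V in blast)
qed

section \<open>Square grids and their boundary integrals\<close>

definition node :: "real \<Rightarrow> int \<Rightarrow> int \<Rightarrow> complex" where
  "node d a b = Complex (d * a) (d * b)"

definition cell :: "real \<Rightarrow> int \<times> int \<Rightarrow> complex set" where
  "cell d c = cbox (node d (fst c) (snd c)) (node d (fst c + 1) (snd c + 1))"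

definition hedge :: "real \<Rightarrow> (complex \<Rightarrow> complex) \<Rightarrow> int \<times> int \<Rightarrow> complex" where
  "hedge d g c = contour_integral (linepath (node d (fst c) (snd c)) (node d (fst c + 1) (snd c))) g"

definition vedge :: "real \<Rightarrow> (complex \<Rightarrow> complex) \<Rightarrow> int \<times> int \<Rightarrow> complex" where
  "vedge d g c = contour_integral (linepath (node d (fst c) (snd c)) (node d (fst c) (snd c + 1))) g"

text \<open>
The integral along the counterclockwise boundary of a cell. The values of \<open>contour_integral\<close> on the
four edges are combined formally, so the expression also makes sense when the integrand is bad on
some edge; such edges cancel in \<open>boundary_integral\<close> when they lie between two cells of the set.
\<close>

definition cell_integral :: "real \<Rightarrow> (complex \<Rightarrow> complex) \<Rightarrow> int \<times> int \<Rightarrow> complex" where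
  "cell_integral d g c =
     hedge d g c + vedge d g (fst c + 1, snd c) - hedge d g (fst c, snd c + 1) - vedge d g c"

definition boundary_integral :: "real \<Rightarrow> (int \<times> int) set \<Rightarrow> (complex \<Rightarrow> complex) \<Rightarrow> complex" where
  "boundary_integral d S g = (\<Sum>c\<in>S. cell_integral d g c)"

definition cells :: "real \<Rightarrow> (int \<times> int) set \<Rightarrow> complex set" where
  "cells d A = (\<Union>c\<in>A. cell d c)"

text \<open>
A set of cells enlarged by one layer. The union of \<open>S\<close> lies in the interior of the union of
\<open>neighbours d S\<close>, so that points on the edges of \<open>S\<close> can be treated by the larger set.
\<close>

definition neighbours :: "real \<Rightarrow> (int \<times> int) set \<Rightarrow> (int \<times> int) set" where
  "neighbours d S = {c. cell d c \<inter> cells d S \<noteq> {}}"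

lemma mem_cell:
  "z \<in> cell d c \<longleftrightarrow> d * fst c \<le> Re z \<and> Re z \<le> d * (fst c + 1) \<and> d * snd c \<le> Im z \<and> Im z \<le> d * (snd c + 1)"
  by (auto simp: cell_def node_def in_cbox_complex_iff)

lemma mem_interior_cell:
  "z \<in> interior (cell d c) \<longleftrightarrow>
     d * fst c < Re z \<and> Re z < d * (fst c + 1) \<and> d * snd c < Im z \<and> Im z < d * (snd c + 1)"
  by (auto simp: cell_def node_def interior_cbox in_box_complex_iff)

lemma mem_cells_iff: "z \<in> cells d A \<longleftrightarrow> (\<exists>c\<in>A. z \<in> cell d c)"
  by (auto simp: cells_def)

lemma cells_mono: "A \<subseteq> B \<Longrightarrow> cells d A \<subseteq> cells d B"
  by (auto simp: cells_def)

lemma mem_cell_floor: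
  assumes "d > 0"
  shows "z \<in> cell d (\<lfloor>Re z / d\<rfloor>, \<lfloor>Im z / d\<rfloor>)"
proof -
  have "d * \<lfloor>x / d\<rfloor> \<le> x \<and> x \<le> d * (\<lfloor>x / d\<rfloor> + 1)" for x
  proof -
    have "d * \<lfloor>x / d\<rfloor> \<le> d * (x / d)" "d * (x / d) \<le> d * (\<lfloor>x / d\<rfloor> + 1)"
      using assms by (intro mult_left_mono; linarith)+
    then show ?thesis using assms by simp
  qed
  then show ?thesis by (simp add: mem_cell)
qed

lemma cells_UNIV: "d > 0 \<Longrightarrow> cells d UNIV = UNIV"
  using mem_cell_floor by (auto simp: cells_def)

lemma finite_cells_meeting:
  assumes "d > 0" "bounded R"
  shows "finite {c. cell d c \<inter> R \<noteq> {}}"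
proof -
  obtain B where B: "\<And>z. z \<in> R \<Longrightarrow> cmod z \<le> B" using assms(2) bounded_iff by blast
  define N where "N = \<lceil>B / d\<rceil> + 1"
  have *: "a \<in> {-N..N}" if "d * of_int a \<le> x" "x \<le> d * (of_int a + 1)" "\<bar>x\<bar> \<le> B" for a :: int and x :: real
  proof -
    have "of_int a \<le> x / d" "x / d \<le> of_int a + 1" using that assms(1) by (simp_all add: field_simps)
    moreover have "\<bar>x / d\<bar> \<le> B / d" using that(3) assms(1) by (simp add: divide_right_mono)
    moreover have "B / d \<le> of_int \<lceil>B / d\<rceil>" by linarith
    ultimately have "of_int a \<le> (of_int \<lceil>B / d\<rceil> :: real)" "- of_int \<lceil>B / d\<rceil> \<le> (of_int a + 1 :: real)"
      by linarith+
    then show ?thesis by (simp add: N_def)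
  qed
  have "{c. cell d c \<inter> R \<noteq> {}} \<subseteq> {-N..N} \<times> {-N..N}"
  proof
    fix c assume "c \<in> {c. cell d c \<inter> R \<noteq> {}}"
    then obtain z where z: "z \<in> cell d c" "z \<in> R" by auto
    have "\<bar>Re z\<bar> \<le> B" "\<bar>Im z\<bar> \<le> B"
      using B[OF z(2)] abs_Re_le_cmod[of z] abs_Im_le_cmod[of z] by linarith+
    then have "fst c \<in> {-N..N}" "snd c \<in> {-N..N}"
      using z(1) *[of "fst c" "Re z"] *[of "snd c" "Im z"] by (auto simp: mem_cell)
    then show "c \<in> {-N..N} \<times> {-N..N}" by (simp add: mem_Times_iff)
  qed
  then show ?thesis by (rule finite_subset) simp
qed

lemma closed_cell: "closed (cell d c)"
  by (simp add: cell_def closed_cbox)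

text \<open>
The grid is locally finite: near any point only finitely many cells have to be considered.
\<close>

lemma closed_cells:
  assumes "d > 0"
  shows "closed (cells d A)"
proof -
  have "\<exists>T. open T \<and> x \<in> T \<and> T \<subseteq> - cells d A" if x: "x \<notin> cells d A" for x
  proof -
    define A' where "A' = {c \<in> A. cell d c \<inter> ball x 1 \<noteq> {}}"
    have "finite A'"
      unfolding A'_def using finite_cells_meeting[OF assms, of "ball x 1"]
      by (rule rev_finite_subset) auto
    then have "closed (cells d A')" unfolding cells_def by (intro closed_UN) (auto simp: closed_cell)
    then have "open (ball x 1 - cells d A')" by (intro open_Diff) auto
    moreover have "x \<in> ball x 1 - cells d A'"
      using x by (auto simp: A'_def cells_def)
    moreover have "ball x 1 - cells d A' \<subseteq> - cells d A"
      by (auto simp: A'_def cells_def)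
    ultimately show ?thesis by blast
  qed
  then have "open (- cells d A)" by (subst open_subopen) auto
  then show ?thesis by (simp add: closed_def)
qed

lemma bounded_cells: "finite A \<Longrightarrow> bounded (cells d A)"
  by (auto simp: cells_def cell_def)

lemma finite_neighbours: "d > 0 \<Longrightarrow> finite S \<Longrightarrow> finite (neighbours d S)"
  unfolding neighbours_def by (intro finite_cells_meeting bounded_cells)

lemma subset_neighbours:
  assumes "d > 0"
  shows "S \<subseteq> neighbours d S"
proof
  fix c assume "c \<in> S"
  moreover have "node d (fst c) (snd c) \<in> cell d c" using assms by (simp add: mem_cell node_def)
  ultimately show "c \<in> neighbours d S" unfolding neighbours_def cells_def by blast
qed

lemma cells_disjoint_outside_neighbours: "cells d S \<inter> cells d (- neighbours d S) = {}"
  unfolding neighbours_def cells_def by blast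

lemma interior_cell_disjoint:
  assumes "d > 0" "z \<in> interior (cell d c)" "z \<in> cell d c'"
  shows "c = c'"
proof -
  have *: "a = b" if "d * of_int a < x" "x < d * (of_int a + 1)" "d * of_int b \<le> x" "x \<le> d * (of_int b + 1)"
    for a b :: int and x :: real
  proof -
    have "d * of_int a < d * (of_int b + 1)" "d * of_int b < d * (of_int a + 1)" using that by linarith+
    then have "of_int a < (of_int b + 1 :: real)" "of_int b < (of_int a + 1 :: real)"
      using assms(1) by simp_all
    then show ?thesis by linarith
  qed
  show ?thesis
    using assms(2,3) *[of "fst c" "Re z" "fst c'"] *[of "snd c" "Im z" "snd c'"]
    by (auto simp: mem_cell mem_interior_cell prod_eq_iff)
qed

text \<open>
Moving a point slightly up and to the right brings it off the grid lines. Identities between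
continuous functions therefore only have to be checked in the interiors of cells.
\<close>

lemma shift_into_interior_cell:
  assumes "d > 0"
  shows "\<forall>\<^sub>F s in at_right 0.
           w + of_real s * (1 + \<i>) \<in> interior (cell d (\<lfloor>Re w / d\<rfloor>, \<lfloor>Im w / d\<rfloor>))"
proof -
  have ev: "\<forall>\<^sub>F s in at_right 0. d * \<lfloor>x / d\<rfloor> < x + s \<and> x + s < d * (\<lfloor>x / d\<rfloor> + 1)" for x
  proof -
    have "d * \<lfloor>x / d\<rfloor> \<le> d * (x / d)" by (intro mult_left_mono) (use assms in linarith)+
    moreover have "d * (x / d) < d * (\<lfloor>x / d\<rfloor> + 1)"
      by (intro mult_strict_left_mono) (use assms in linarith)+
    ultimately have *: "d * \<lfloor>x / d\<rfloor> \<le> x" "x < d * (\<lfloor>x / d\<rfloor> + 1)" using assms by simp_all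
    show ?thesis
      unfolding eventually_at_right_field
      by (rule exI[of _ "d * (\<lfloor>x / d\<rfloor> + 1) - x"]) (use * in auto)
  qed
  show ?thesis
    using ev[of "Re w"] ev[of "Im w"] by eventually_elim (simp add: mem_interior_cell)
qed

lemma horizontal_edge_subset:
  assumes "d > 0"
  shows "closed_segment (node d a b) (node d (a + 1) b) \<subseteq> cell d (a, b) \<inter> cell d (a, b - 1)"
  using assms
  by (auto simp: mem_cell node_def closed_segment_same_Im closed_segment_eq_real_ivl algebra_simps)

lemma vertical_edge_subset:
  assumes "d > 0"
  shows "closed_segment (node d a b) (node d a (b + 1)) \<subseteq> cell d (a, b) \<inter> cell d (a - 1, b)"
  using assms
  by (auto simp: mem_cell node_def closed_segment_same_Re closed_segment_eq_real_ivl algebra_simps)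

lemma sum_difference_shift:
  fixes h :: "'a \<Rightarrow> complex"
  assumes "finite S" "inj_on \<sigma> S"
  shows "(\<Sum>c\<in>S. h c - h (\<sigma> c)) = (\<Sum>c\<in>S - \<sigma> ` S. h c) - (\<Sum>c\<in>\<sigma> ` S - S. h c)"
proof -
  have "(\<Sum>c\<in>S. h c - h (\<sigma> c)) = sum h S - sum h (\<sigma> ` S)"
    by (simp add: sum_subtractf sum.reindex[OF assms(2)])
  also have "sum h S = sum h (S - \<sigma> ` S) + sum h (S \<inter> \<sigma> ` S)"
    using assms(1) by (subst sum.union_disjoint[symmetric]) (auto intro!: arg_cong[of _ _ "sum h"])
  also have "sum h (\<sigma> ` S) = sum h (\<sigma> ` S - S) + sum h (S \<inter> \<sigma> ` S)"
    using assms(1) by (subst sum.union_disjoint[symmetric]) (auto intro!: arg_cong[of _ _ "sum h"])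
  finally show ?thesis by simp
qed

text \<open>
An edge shared by two cells of \<open>S\<close> is traversed once in each direction. What remains are the edges
with exactly one of the two adjacent cells in \<open>S\<close>.
\<close>

lemma boundary_integral_edges:
  assumes "finite S"
  defines "up \<equiv> (\<lambda>c. (fst c, snd c + 1))" and "right \<equiv> (\<lambda>c. (fst c + 1, snd c))"
  shows "boundary_integral d S g =
           (\<Sum>c\<in>S - up ` S. hedge d g c) - (\<Sum>c\<in>up ` S - S. hedge d g c)
         - (\<Sum>c\<in>S - right ` S. vedge d g c) + (\<Sum>c\<in>right ` S - S. vedge d g c)"
proof -
  have inj: "inj_on up S" "inj_on right S" by (auto simp: inj_on_def up_def right_def prod_eq_iff)
  have "boundary_integral d S g =
          (\<Sum>c\<in>S. hedge d g c - hedge d g (up c)) - (\<Sum>c\<in>S. vedge d g c - vedge d g (right c))"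
    by (simp add: boundary_integral_def cell_integral_def up_def right_def sum_subtractf sum.distrib)
  then show ?thesis
    by (simp add: sum_difference_shift[OF assms(1) inj(1)] sum_difference_shift[OF assms(1) inj(2)])
qed

text \<open>
The common form of all regularity statements about boundary integrals: a property that is preserved
by sums and differences only has to be verified for integrals over segments that lie both in a cell
of \<open>S\<close> and in a cell outside \<open>S\<close>. When \<open>S\<close> contains all cells that meet a set, such segments avoid
that set.
\<close>

lemma boundary_integral_closure:
  fixes G :: "'a \<Rightarrow> complex \<Rightarrow> complex"
  assumes "d > 0" "finite S"
    and zero: "P (\<lambda>z. 0)"
    and add: "\<And>f g. P f \<Longrightarrow> P g \<Longrightarrow> P (\<lambda>z. f z + g z)"
    and diff: "\<And>f g. P f \<Longrightarrow> P g \<Longrightarrow> P (\<lambda>z. f z - g z)"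
    and edge: "\<And>p q. closed_segment p q \<subseteq> cells d S \<inter> cells d (- S)
                 \<Longrightarrow> P (\<lambda>z. contour_integral (linepath p q) (G z))"
  shows "P (\<lambda>z. boundary_integral d S (G z))"
proof -
  have sum: "P (\<lambda>z. \<Sum>a\<in>A. F a z)" if "finite A" "\<And>a. a \<in> A \<Longrightarrow> P (F a)" for A and F :: "int \<times> int \<Rightarrow> 'a \<Rightarrow> complex"
    using that by (induction A rule: finite_induct) (auto intro: zero add)
  have h: "P (\<lambda>z. hedge d (G z) c)" if "(c \<in> S) \<noteq> ((fst c, snd c - 1) \<in> S)" for c
    unfolding hedge_def
    by (rule edge) (use horizontal_edge_subset[OF assms(1), of "fst c" "snd c", unfolded prod.collapse] that in
        \<open>unfold cells_def, blast\<close>)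
  have v: "P (\<lambda>z. vedge d (G z) c)" if "(c \<in> S) \<noteq> ((fst c - 1, snd c) \<in> S)" for c
    unfolding vedge_def
    by (rule edge) (use vertical_edge_subset[OF assms(1), of "fst c" "snd c", unfolded prod.collapse] that in
        \<open>unfold cells_def, blast\<close>)
  show ?thesis
    unfolding boundary_integral_edges[OF assms(2)]
    using assms(2)
    by (intro diff add sum h v) (force simp: image_iff)+
qed

lemma cell_integral_eq_rectpath:
  assumes "d > 0" "\<And>p q. closed_segment p q \<subseteq> frontier (cell d c) \<Longrightarrow> g contour_integrable_on linepath p q"
  shows "cell_integral d g c =
    contour_integral (rectpath (node d (fst c) (snd c)) (node d (fst c + 1) (snd c + 1))) g"
proof -
  obtain a b where c: "c = (a, b)" by fastforce
  let ?p1 = "node d a b" and ?p2 = "node d (a + 1) b" and ?p3 = "node d (a + 1) (b + 1)" and ?p4 = "node d a (b + 1)"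
  have "d * a \<le> d * (a + 1)" "d * b \<le> d * (b + 1)" using assms(1) by simp_all
  then have fr: "path_image (rectpath ?p1 ?p3) = frontier (cell d c)"
    by (subst path_image_rectpath_cbox_minus_box)
       (auto simp: node_def cell_def c frontier_cbox)
  have r: "rectpath ?p1 ?p3 = linepath ?p1 ?p2 +++ linepath ?p2 ?p3 +++ linepath ?p3 ?p4 +++ linepath ?p4 ?p1"
    by (simp add: rectpath_def node_def Let_def)
  have "closed_segment ?p1 ?p2 \<subseteq> frontier (cell d c)" "closed_segment ?p2 ?p3 \<subseteq> frontier (cell d c)"
    "closed_segment ?p3 ?p4 \<subseteq> frontier (cell d c)" "closed_segment ?p4 ?p1 \<subseteq> frontier (cell d c)"
    unfolding fr[symmetric] r by (auto simp: path_image_join)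
  then have i: "g contour_integrable_on linepath ?p1 ?p2" "g contour_integrable_on linepath ?p2 ?p3"
    "g contour_integrable_on linepath ?p3 ?p4" "g contour_integrable_on linepath ?p4 ?p1"
    using assms(2) by blast+
  have rev: "contour_integral (linepath y x) g = - contour_integral (linepath x y) g" for x y
    using contour_integral_reversepath[of "linepath x y" g] by simp
  show ?thesis
    unfolding c fst_conv snd_conv r using i rev[of ?p3 ?p4] rev[of ?p4 ?p1]
    by (simp add: contour_integrable_join cell_integral_def hedge_def vedge_def)
qed

lemma cell_integral_eq_0:
  assumes "d > 0" "g holomorphic_on cell d c"
  shows "cell_integral d g c = 0"
proof -
  have le: "d * fst c \<le> d * (fst c + 1)" "d * snd c \<le> d * (snd c + 1)" using assms(1) by simp_all
  have "g contour_integrable_on linepath p q" if "closed_segment p q \<subseteq> frontier (cell d c)" for p q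
    using that assms(2) closed_cell[of d c]
    by (meson contour_integrable_continuous_linepath continuous_on_subset frontier_subset_closed
        holomorphic_on_imp_continuous_on)
  then have "cell_integral d g c =
    contour_integral (rectpath (node d (fst c) (snd c)) (node d (fst c + 1) (snd c + 1))) g"
    by (rule cell_integral_eq_rectpath[OF assms(1)])
  also have "\<dots> = 0"
  proof (intro contour_integral_unique Cauchy_theorem_convex_simple[OF assms(2)])
    show "path_image (rectpath (node d (fst c) (snd c)) (node d (fst c + 1) (snd c + 1))) \<subseteq> cell d c"
      unfolding cell_def by (rule path_image_rectpath_subset_cbox) (use le in \<open>simp_all add: node_def\<close>)
  qed (auto simp: cell_def)
  finally show ?thesis .
qed

lemma cell_integral_Cauchy:
  assumes "d > 0" "f holomorphic_on cell d c" "w \<in> interior (cell d c)"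
  shows "cell_integral d (\<lambda>\<zeta>. f \<zeta> / (\<zeta> - w)) c = 2 * pi * \<i> * f w"
proof -
  have le: "d * fst c \<le> d * (fst c + 1)" "d * snd c \<le> d * (snd c + 1)" using assms(1) by simp_all
  let ?r = "rectpath (node d (fst c) (snd c)) (node d (fst c + 1) (snd c + 1))"
  have fr: "path_image ?r = frontier (cell d c)"
    using le by (subst path_image_rectpath_cbox_minus_box) (auto simp: node_def cell_def frontier_cbox)
  have w: "w \<in> box (node d (fst c) (snd c)) (node d (fst c + 1) (snd c + 1))"
    using assms(3) by (simp add: cell_def interior_cbox)
  have sub: "frontier (cell d c) \<subseteq> cell d c - {w}"
    using assms(3) closed_cell[of d c] by (auto simp: frontier_def)
  have "(\<lambda>\<zeta>. f \<zeta> / (\<zeta> - w)) contour_integrable_on linepath p q" if "closed_segment p q \<subseteq> frontier (cell d c)" for p q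
  proof (rule contour_integrable_continuous_linepath)
    have "continuous_on (closed_segment p q) f"
      using that sub assms(2) by (meson Diff_subset continuous_on_subset holomorphic_on_imp_continuous_on subset_trans)
    then show "continuous_on (closed_segment p q) (\<lambda>\<zeta>. f \<zeta> / (\<zeta> - w))"
      using that sub by (intro continuous_intros) auto
  qed
  then have "cell_integral d (\<lambda>\<zeta>. f \<zeta> / (\<zeta> - w)) c = contour_integral ?r (\<lambda>\<zeta>. f \<zeta> / (\<zeta> - w))"
    by (rule cell_integral_eq_rectpath[OF assms(1)])
  also have "\<dots> = 2 * pi * \<i> * winding_number ?r w * f w"
    by (intro contour_integral_unique Cauchy_integral_formula_convex_simple[OF _ assms(2,3)])
       (use fr sub in \<open>auto simp: cell_def\<close>)
  also have "winding_number ?r w = 1" using w by (rule winding_number_rectpath)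
  finally show ?thesis by simp
qed

definition cauchy_grid :: "real \<Rightarrow> (int \<times> int) set \<Rightarrow> (complex \<Rightarrow> complex) \<Rightarrow> complex \<Rightarrow> complex" where
  "cauchy_grid d S f w = boundary_integral d S (\<lambda>\<zeta>. f \<zeta> / (\<zeta> - w)) / (2 * pi * \<i>)"

text \<open>
Passing from \<open>S\<close> to \<open>S'\<close> adds integrals over cells on which \<open>f\<close> is holomorphic. By Cauchy's theorem
and Cauchy's formula only the cell around \<open>w\<close> contributes, and it contributes \<open>f w\<close>.
\<close>

lemma cauchy_grid_difference:
  assumes "d > 0" "finite S'" "S \<subseteq> S'" "c \<in> S' - S" "w \<in> interior (cell d c)"
    and hol: "\<And>c. c \<in> S' - S \<Longrightarrow> f holomorphic_on cell d c"
  shows "cauchy_grid d S' f w = cauchy_grid d S f w + f w"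
proof -
  let ?g = "\<lambda>\<zeta>. f \<zeta> / (\<zeta> - w)"
  have "boundary_integral d S' ?g = boundary_integral d (S' - S) ?g + boundary_integral d S ?g"
    unfolding boundary_integral_def by (rule sum.subset_diff[OF assms(3,2)])
  also have "boundary_integral d (S' - S) ?g = cell_integral d ?g c + (\<Sum>c'\<in>S' - S - {c}. cell_integral d ?g c')"
    unfolding boundary_integral_def using assms(2,4) by (intro sum.remove) auto
  also have "(\<Sum>c'\<in>S' - S - {c}. cell_integral d ?g c') = 0"
  proof (intro sum.neutral ballI)
    fix c' assume c': "c' \<in> S' - S - {c}"
    then have "w \<notin> cell d c'" using interior_cell_disjoint[OF assms(1,5)] by blast
    then have "?g holomorphic_on cell d c'"
      using hol c' by (intro holomorphic_intros) auto
    then show "cell_integral d ?g c' = 0" by (rule cell_integral_eq_0[OF assms(1)])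
  qed
  also have "cell_integral d ?g c = 2 * pi * \<i> * f w"
    using assms by (intro cell_integral_Cauchy) auto
  finally show ?thesis by (simp add: cauchy_grid_def add_divide_distrib)
qed

lemma holomorphic_cauchy_grid:
  assumes "d > 0" "finite S" and cont: "continuous_on (cells d S \<inter> cells d (- S)) f"
    and V: "open V" "V \<inter> (cells d S \<inter> cells d (- S)) = {}"
  shows "cauchy_grid d S f holomorphic_on V"
proof -
  have "(\<lambda>w. boundary_integral d S (\<lambda>\<zeta>. f \<zeta> / (\<zeta> - w))) holomorphic_on V"
  proof (rule boundary_integral_closure[where P = "\<lambda>h. h holomorphic_on V", OF assms(1,2)])
    fix p q assume pq: "closed_segment p q \<subseteq> cells d S \<inter> cells d (- S)"
    show "(\<lambda>w. contour_integral (linepath p q) (\<lambda>\<zeta>. f \<zeta> / (\<zeta> - w))) holomorphic_on V"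
    proof (rule holomorphic_on_linepath_param[OF V(1)])
      have "continuous_on (V \<times> closed_segment p q) (\<lambda>x. f (snd x))"
        by (rule continuous_on_compose2[OF cont]) (use pq in \<open>auto intro!: continuous_intros\<close>)
      then show "continuous_on (V \<times> closed_segment p q) (\<lambda>(w, \<zeta>). f \<zeta> / (\<zeta> - w))"
        unfolding split_beta using V(2) pq by (intro continuous_intros) auto
      show "(\<lambda>w. f \<zeta> / (\<zeta> - w)) holomorphic_on V" if "\<zeta> \<in> closed_segment p q" for \<zeta>
        using that pq V(2) by (intro holomorphic_intros) auto
    qed
  qed (auto intro!: holomorphic_intros)
  then show ?thesis unfolding cauchy_grid_def[abs_def] by (intro holomorphic_intros) auto
qed

lemma cauchy_grid_tendsto_0:
  assumes "d > 0" "finite S" and cont: "continuous_on (cells d S \<inter> cells d (- S)) f"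
  shows "(cauchy_grid d S f \<longlongrightarrow> 0) at_infinity"
proof -
  have "((\<lambda>w. boundary_integral d S (\<lambda>\<zeta>. f \<zeta> / (\<zeta> - w))) \<longlongrightarrow> 0) at_infinity"
  proof (rule boundary_integral_closure[where P = "\<lambda>h. (h \<longlongrightarrow> 0) at_infinity", OF assms(1,2)])
    fix p q assume pq: "closed_segment p q \<subseteq> cells d S \<inter> cells d (- S)"
    have contpq: "continuous_on (closed_segment p q) f" using cont pq continuous_on_subset by blast
    obtain M where M: "\<And>\<zeta>. \<zeta> \<in> closed_segment p q \<Longrightarrow> cmod (f \<zeta>) \<le> M"
      using compact_imp_bounded[OF compact_continuous_image[OF contpq compact_segment]]
      by (auto simp: bounded_iff)
    obtain R where R: "\<And>\<zeta>. \<zeta> \<in> closed_segment p q \<Longrightarrow> cmod \<zeta> \<le> R"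
      using bounded_closed_segment[of p q] by (auto simp: bounded_iff)
    have "M \<ge> 0" using M[of p] norm_ge_zero[of "f p"] by (simp del: norm_ge_zero)
    show "((\<lambda>w. contour_integral (linepath p q) (\<lambda>\<zeta>. f \<zeta> / (\<zeta> - w))) \<longlongrightarrow> 0) at_infinity"
    proof (rule Lim_null_comparison)
      have "\<forall>\<^sub>F w in at_infinity. R < cmod w"
        unfolding eventually_at_infinity by (rule exI[of _ "R + 1"]) auto
      then show "\<forall>\<^sub>F w in at_infinity. norm (contour_integral (linepath p q) (\<lambda>\<zeta>. f \<zeta> / (\<zeta> - w)))
                    \<le> M * cmod (q - p) / (cmod w - R)"
      proof eventually_elim
        fix w assume w: "R < cmod w"
        have nz: "cmod w - R \<le> cmod (\<zeta> - w)" if "\<zeta> \<in> closed_segment p q" for \<zeta>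
          using R[OF that] norm_triangle_ineq2[of w \<zeta>] by (simp add: norm_minus_commute)
        have "continuous_on (closed_segment p q) (\<lambda>\<zeta>. f \<zeta> / (\<zeta> - w))"
          using nz w by (intro continuous_intros contpq) fastforce
        then have int: "(\<lambda>\<zeta>. f \<zeta> / (\<zeta> - w)) contour_integrable_on linepath p q"
          by (rule contour_integrable_continuous_linepath)
        have "cmod (contour_integral (linepath p q) (\<lambda>\<zeta>. f \<zeta> / (\<zeta> - w))) \<le> (M / (cmod w - R)) * cmod (q - p)"
        proof (rule contour_integral_bound_linepath[OF int])
          show "0 \<le> M / (cmod w - R)" using \<open>M \<ge> 0\<close> w by simp
          fix \<zeta> assume \<zeta>: "\<zeta> \<in> closed_segment p q"
          show "cmod (f \<zeta> / (\<zeta> - w)) \<le> M / (cmod w - R)"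
            unfolding norm_divide using M[OF \<zeta>] nz[OF \<zeta>] w \<open>M \<ge> 0\<close> by (intro frac_le) auto
        qed
        then show "norm (contour_integral (linepath p q) (\<lambda>\<zeta>. f \<zeta> / (\<zeta> - w)))
                    \<le> M * cmod (q - p) / (cmod w - R)" by simp
      qed
      have "filterlim (\<lambda>w::complex. cmod w - R) at_top at_infinity"
        by (rule filterlim_tendsto_add_at_top[of "\<lambda>_. - R" "- R" _ cmod, simplified, OF filterlim_norm_at_top, unfolded add.commute[of "- R"], simplified])
      then show "((\<lambda>w. M * cmod (q - p) / (cmod w - R)) \<longlongrightarrow> 0) at_infinity"
        by (intro tendsto_divide_0[OF tendsto_const] filterlim_at_top_imp_at_infinity)
    qed
  qed (auto intro!: tendsto_eq_intros)
  from tendsto_divide[OF this tendsto_const[of "2 * pi * \<i>"]]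
  show ?thesis unfolding cauchy_grid_def[abs_def] by simp
qed

section \<open>Splitting off the singularities on a compact set\<close>

text \<open>
The analogue, for a compact set \<open>K\<close> in an open set \<open>U\<close>, of splitting a Laurent series into its
regular part \<open>f1\<close> and its principal part \<open>f2\<close>.
\<close>

definition laurent_splitting ::
    "complex set \<Rightarrow> complex set \<Rightarrow> (complex \<Rightarrow> complex) \<Rightarrow> (complex \<Rightarrow> complex) \<Rightarrow> (complex \<Rightarrow> complex) \<Rightarrow> bool" where
  "laurent_splitting U K f f1 f2 \<longleftrightarrow>
     f1 holomorphic_on U \<and> f2 holomorphic_on - K \<and> (f2 \<longlongrightarrow> 0) at_infinity \<and>
     (\<forall>w\<in>U - K. f w = f1 w + f2 w)"

text \<open>
The difference of the regular parts and the negative difference of the principal parts agree on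
\<open>U - K\<close>. Together they form an entire function that vanishes at infinity.
\<close>

lemma laurent_splitting_unique:
  assumes "laurent_splitting U K f f1 f2" "laurent_splitting U K f g1 g2"
    and "open U" "closed K" "bounded K" "K \<subseteq> U" "w \<in> U"
  shows "f1 w = g1 w"
proof -
  \<comment> \<open>the entire function glued from the two differences\<close>
  define h where "h = (\<lambda>w. if w \<in> U then f1 w - g1 w else g2 w - f2 w)"
  have eq: "f1 w - g1 w = g2 w - f2 w" if "w \<in> U - K" for w
    using assms(1,2) that unfolding laurent_splitting_def by (metis add_diff_cancel_left' add_diff_eq diff_add_eq diff_diff_eq2 add.commute)
  have h2: "h w = g2 w - f2 w" if "w \<in> - K" for w
    using eq that by (auto simp: h_def)
  have "h holomorphic_on U"
    by (rule holomorphic_transform[of "\<lambda>w. f1 w - g1 w"])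
       (use assms(1,2) in \<open>auto simp: h_def laurent_splitting_def intro!: holomorphic_intros\<close>)
  moreover have hK: "h holomorphic_on - K"
    by (rule holomorphic_transform[of "\<lambda>w. g2 w - f2 w"])
       (use assms(1,2) h2 in \<open>auto simp: laurent_splitting_def intro!: holomorphic_intros\<close>)
  ultimately have "h holomorphic_on U \<union> - K"
    using assms by (intro holomorphic_on_Un) auto
  moreover have "U \<union> - K = UNIV" using assms(6) by blast
  ultimately have "h holomorphic_on UNIV" by simp
  moreover have "(h \<longlongrightarrow> 0) at_infinity"
  proof (rule Lim_transform_eventually)
    show "((\<lambda>w. g2 w - f2 w) \<longlongrightarrow> 0) at_infinity"
      using assms(1,2) tendsto_diff[of g2 0 at_infinity f2 0] by (simp add: laurent_splitting_def)
    obtain R where "\<And>w. w \<in> K \<Longrightarrow> cmod w \<le> R" using assms(5) bounded_iff by blast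
    then show "\<forall>\<^sub>F w in at_infinity. g2 w - f2 w = h w"
      unfolding eventually_at_infinity
      using h2 by (intro exI[of _ "R + 1"]) (metis ComplI add.commute add_le_same_cancel1 not_one_le_zero order_trans)
  qed
  ultimately have "h w = 0" by (rule Liouville_weak)
  then show ?thesis using assms(7) by (simp add: h_def)
qed

text \<open>
With \<open>S\<close> containing all cells that meet \<open>K\<close>, the Cauchy integral over the boundary of \<open>S'\<close> gives the
regular part near the union of \<open>S\<close>, and minus the Cauchy integral over the boundary of \<open>S\<close> gives the
principal part off that union. On the layer between them both descriptions apply, and they are
compatible there by \<open>cauchy_grid_difference\<close>: first in the interiors of cells, then everywhere by
continuity. The second claim records that near the union of \<open>S\<close> the regular part is given by an
integral over a fixed contour; this is what allows parameters.
\<close>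

lemma laurent_splitting_grid:
  assumes d: "d > 0" and U: "open U" and K: "closed K"
    and f: "f holomorphic_on U - K"
    and S: "finite S" "\<And>c. c \<notin> S \<Longrightarrow> cell d c \<inter> K = {}"
  defines "S' \<equiv> (neighbours d S)"
  assumes sub: "cells d S' \<subseteq> U"
  defines "f1 \<equiv> (\<lambda>w. if w \<in> cells d S then cauchy_grid d S' f w else f w + cauchy_grid d S f w)"
  shows "\<exists>f2. laurent_splitting U K f f1 f2"
    and "\<And>w. w \<notin> cells d (- S') \<Longrightarrow> f1 w = cauchy_grid d S' f w"
proof -
  let ?T = "cells d S" and ?T' = "cells d S'" and ?O = "- cells d (- S')"
  have finS': "finite S'" unfolding S'_def by (rule finite_neighbours[OF d S(1)])
  have SS': "S \<subseteq> S'" unfolding S'_def by (rule subset_neighbours[OF d])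
  have KT: "K \<subseteq> ?T" using S(2) cells_UNIV[OF d] by (fastforce simp: cells_def)
  have cov: "- cells d (- A) \<subseteq> cells d A" for A
    using cells_UNIV[OF d] by (fastforce simp: cells_def)
  have TO: "?T \<subseteq> ?O" using cells_disjoint_outside_neighbours[of d S] unfolding S'_def by blast
  have offK: "cells d (- S) \<inter> K = {}" "cells d (- S') \<inter> K = {}"
    using S(2) SS' by (fastforce simp: cells_def)+
  have contf: "continuous_on (U - K) f" using f holomorphic_on_imp_continuous_on by blast
  have cont: "continuous_on (?T \<inter> cells d (- S)) f" "continuous_on (?T' \<inter> cells d (- S')) f"
    using offK sub cells_mono[OF SS', of d] by (auto intro!: continuous_on_subset[OF contf])
  have opT: "open (- ?T)" and opO: "open ?O" using closed_cells[OF d] by auto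
  have hS: "cauchy_grid d S f holomorphic_on - ?T"
    by (rule holomorphic_cauchy_grid[OF d S(1) cont(1) opT]) auto
  have hS': "cauchy_grid d S' f holomorphic_on ?O"
    by (rule holomorphic_cauchy_grid[OF d finS' cont(2) opO]) auto
  have glue: "f w + cauchy_grid d S f w = cauchy_grid d S' f w" if w: "w \<in> ?O - ?T" for w
  proof -
    have opW: "open (?O - ?T)" using opO opT by (auto intro: open_Diff closed_cells[OF d])
    have "?O - ?T \<subseteq> U - K" using cov[of S'] sub KT by blast
    then have hf: "f holomorphic_on ?O - ?T" using f holomorphic_on_subset by blast
    have hD: "(\<lambda>w. f w + cauchy_grid d S f w - cauchy_grid d S' f w) holomorphic_on ?O - ?T"
      using hf hS hS' by (intro holomorphic_intros) (auto intro: holomorphic_on_subset)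
    let ?D = "\<lambda>w. f w + cauchy_grid d S f w - cauchy_grid d S' f w"
    \<comment> \<open>the difference of the two descriptions is continuous and vanishes in interiors of cells\<close>
    have isC: "isCont ?D w"
      using holomorphic_on_imp_continuous_on[OF hD] opW w continuous_on_eq_continuous_at by blast
    have lim: "((\<lambda>s. w + of_real s * (1 + \<i>)) \<longlongrightarrow> w) (at_right 0)"
      by (auto intro!: tendsto_eq_intros)
    have "((\<lambda>s. ?D (w + of_real s * (1 + \<i>))) \<longlongrightarrow> ?D w) (at_right 0)"
      by (rule isCont_tendsto_compose[OF isC lim])
    moreover have "\<forall>\<^sub>F s in at_right 0. ?D (w + of_real s * (1 + \<i>)) = 0"
      using shift_into_interior_cell[OF d, of w] topological_tendstoD[OF lim opW w]
    proof eventually_elim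
      fix s :: real
      let ?w = "w + of_real s * (1 + \<i>)" and ?c = "(\<lfloor>Re w / d\<rfloor>, \<lfloor>Im w / d\<rfloor>)"
      assume s: "?w \<in> interior (cell d ?c)" "?w \<in> ?O - ?T"
      have "?w \<in> cell d ?c" using s(1) interior_subset by blast
      then have c: "?c \<in> S' - S" using s(2) by (auto simp: mem_cells_iff)
      have "cauchy_grid d S' f ?w = cauchy_grid d S f ?w + f ?w"
      proof (rule cauchy_grid_difference[OF d finS' SS' c s(1)])
        fix c' assume "c' \<in> S' - S"
        then have "cell d c' \<subseteq> U - K" using sub S(2)[of c'] unfolding cells_def by blast
        then show "f holomorphic_on cell d c'" using f holomorphic_on_subset by blast
      qed
      then show "?D ?w = 0" by simp
    qed
    ultimately have "((\<lambda>s::real. 0) \<longlongrightarrow> ?D w) (at_right 0)"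
      by (rule Lim_transform_eventually)
    then have "?D w = 0" by (simp add: tendsto_const_iff)
    then show ?thesis by simp
  qed
  show f1O: "f1 w = cauchy_grid d S' f w" if "w \<notin> cells d (- S')" for w
    using glue that by (auto simp: f1_def)
  have h1: "f1 holomorphic_on U"
  proof -
    have "f1 holomorphic_on ?O \<inter> U"
      by (rule holomorphic_transform[of "cauchy_grid d S' f"])
         (use hS' holomorphic_on_subset f1O in auto)
    moreover have "f1 holomorphic_on U - ?T"
    proof (rule holomorphic_transform[of "\<lambda>w. f w + cauchy_grid d S f w"])
      show "(\<lambda>w. f w + cauchy_grid d S f w) holomorphic_on U - ?T"
        using f hS KT by (intro holomorphic_intros) (auto intro: holomorphic_on_subset)
    qed (auto simp: f1_def)
    ultimately have "f1 holomorphic_on (?O \<inter> U) \<union> (U - ?T)"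
      using opO U closed_cells[OF d] by (intro holomorphic_on_Un) (auto intro: open_Diff)
    moreover have "(?O \<inter> U) \<union> (U - ?T) = U" using TO by blast
    ultimately show ?thesis by simp
  qed
  define f2 where "f2 = (\<lambda>w. if w \<in> ?T then f w - cauchy_grid d S' f w else - cauchy_grid d S f w)"
  have "f2 holomorphic_on - K"
  proof -
    have OU: "?O \<subseteq> U" using cov[of S'] sub by blast
    have "f2 holomorphic_on ?O - K"
    proof (rule holomorphic_transform[of "\<lambda>w. f w - cauchy_grid d S' f w"])
      show "(\<lambda>w. f w - cauchy_grid d S' f w) holomorphic_on ?O - K"
        using f hS' OU by (intro holomorphic_intros) (auto intro: holomorphic_on_subset)
      show "f w - cauchy_grid d S' f w = f2 w" if "w \<in> ?O - K" for w
        using glue[of w, symmetric] that by (auto simp: f2_def)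
    qed
    moreover have "f2 holomorphic_on - ?T"
      by (rule holomorphic_transform[of "\<lambda>w. - cauchy_grid d S f w"])
         (use hS in \<open>auto simp: f2_def intro!: holomorphic_intros\<close>)
    ultimately have "f2 holomorphic_on (?O - K) \<union> - ?T"
      using opO opT K by (intro holomorphic_on_Un) (auto intro: open_Diff)
    moreover have "(?O - K) \<union> - ?T = - K" using TO KT by blast
    ultimately show ?thesis by simp
  qed
  moreover have "(f2 \<longlongrightarrow> 0) at_infinity"
  proof (rule Lim_transform_eventually)
    show "((\<lambda>w. - cauchy_grid d S f w) \<longlongrightarrow> 0) at_infinity"
      using tendsto_minus[OF cauchy_grid_tendsto_0[OF d S(1) cont(1)]] by simp
    obtain R where "\<And>w. w \<in> ?T \<Longrightarrow> cmod w \<le> R" using bounded_cells[OF S(1)] bounded_iff by blast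
    then show "\<forall>\<^sub>F w in at_infinity. - cauchy_grid d S f w = f2 w"
      unfolding eventually_at_infinity f2_def by (intro exI[of _ "R + 1"]) fastforce
  qed
  ultimately show "\<exists>f2. laurent_splitting U K f f1 f2"
    using h1 by (intro exI[of _ f2]) (auto simp: laurent_splitting_def f1_def f2_def)
qed

section \<open>Hartogs extension\<close>

definition coord_update :: "'n \<Rightarrow> complex ^ 'n \<Rightarrow> complex \<Rightarrow> complex ^ 'n" where
  "coord_update i z \<zeta> = (\<chi> k. if k = i then \<zeta> else z $ k)"

definition slice :: "'n \<Rightarrow> (complex ^ 'n) set \<Rightarrow> complex ^ 'n \<Rightarrow> complex set" where
  "slice i A z = {\<zeta>. coord_update i z \<zeta> \<in> A}"

lemma coord_update_component [simp]: "coord_update i z \<zeta> $ k = (if k = i then \<zeta> else z $ k)"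
  by (simp add: coord_update_def)

lemma coord_update_self [simp]: "coord_update i z (z $ i) = z"
  by (simp add: vec_eq_iff)

lemma component_in_slice_iff [simp]: "z $ i \<in> slice i A z \<longleftrightarrow> z \<in> A"
  by (simp add: slice_def)

lemma slice_Diff: "slice i (A - B) z = slice i A z - slice i B z"
  by (auto simp: slice_def)

lemma slice_mono: "A \<subseteq> B \<Longrightarrow> slice i A z \<subseteq> slice i B z"
  by (auto simp: slice_def)

lemma continuous_on_coord_update:
  assumes "continuous_on S u" "continuous_on S v"
  shows "continuous_on S (\<lambda>x. coord_update i (u x) (v x))"
proof (rule continuous_on_vec_components)
  fix k show "continuous_on S (\<lambda>x. coord_update i (u x) (v x) $ k)"
    using assms by (cases "k = i") (auto intro!: continuous_intros)
qed

lemma open_slice: "open A \<Longrightarrow> open (slice i A z)"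
  unfolding slice_def vimage_def[symmetric]
  by (rule open_vimage) (auto intro!: continuous_on_coord_update continuous_intros)

lemma closed_slice: "closed A \<Longrightarrow> closed (slice i A z)"
  unfolding slice_def vimage_def[symmetric]
  by (rule closed_vimage) (auto intro!: continuous_on_coord_update continuous_intros)

lemma bounded_slice:
  assumes "bounded A"
  shows "bounded (slice i A z)"
proof -
  have "slice i A z \<subseteq> (\<lambda>w. w $ i) ` A"
  proof
    fix \<zeta> assume "\<zeta> \<in> slice i A z"
    then show "\<zeta> \<in> (\<lambda>w. w $ i) ` A"
      unfolding slice_def by (intro image_eqI[of _ _ "coord_update i z \<zeta>"]) auto
  qed
  then show ?thesis using bounded_component_cart[OF assms] bounded_subset by blast
qed

lemma dist_coord_update_le:
  "dist (coord_update i z \<zeta>) (coord_update i w \<xi>) \<le> dist z w + cmod (\<zeta> - \<xi>)"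
proof -
  have "dist (coord_update i z \<zeta>) (coord_update i w \<zeta>) \<le> dist z w"
    unfolding dist_norm by (rule norm_le_componentwise_cart) auto
  moreover have "dist (coord_update i w \<zeta>) (coord_update i w \<xi>) \<le> cmod (\<zeta> - \<xi>)"
  proof -
    have "norm (coord_update i w \<zeta> - coord_update i w \<xi>) \<le> (\<Sum>k\<in>UNIV. cmod ((coord_update i w \<zeta> - coord_update i w \<xi>) $ k))"
      unfolding norm_vec_def by (rule L2_set_le_sum) auto
    also have "\<dots> = (\<Sum>k\<in>UNIV. if k = i then cmod (\<zeta> - \<xi>) else 0)"
      by (rule sum.cong) auto
    finally show ?thesis by (simp add: dist_norm)
  qed
  ultimately show ?thesis
    using dist_triangle[of "coord_update i z \<zeta>" "coord_update i w \<xi>" "coord_update i w \<zeta>"] by linarith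
qed

lemma disc_holomorphic_slice:
  assumes "disc_holomorphic f A" "open A"
  shows "(\<lambda>\<zeta>. f (coord_update i z \<zeta>)) holomorphic_on slice i A z"
proof (rule disc_holomorphicD[OF assms(1) open_slice[OF assms(2)]])
  show "(\<lambda>t. coord_update i z t $ k) holomorphic_on slice i A z" for k
    by (cases "k = i") auto
qed (auto simp: slice_def)

lemma disc_holomorphic_coord_update:
  fixes W :: "(complex ^ 'n) set"
  assumes f: "disc_holomorphic f A" and sub: "\<And>z. z \<in> W \<Longrightarrow> coord_update i z \<zeta> \<in> A"
  shows "disc_holomorphic (\<lambda>z. f (coord_update i z \<zeta>)) W"
  unfolding disc_holomorphic_def
proof (intro conjI allI impI)
  show "continuous_on W (\<lambda>z. f (coord_update i z \<zeta>))"
    by (rule continuous_on_compose2[OF disc_holomorphic_imp_continuous_on[OF f]])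
       (use sub in \<open>auto intro!: continuous_on_coord_update continuous_intros\<close>)
  fix V and \<phi> :: "complex \<Rightarrow> complex ^ 'n"
  assume V: "open V" "\<forall>k. (\<lambda>t. \<phi> t $ k) holomorphic_on V" "\<phi> ` V \<subseteq> W"
  show "(\<lambda>t. f (coord_update i (\<phi> t) \<zeta>)) holomorphic_on V"
  proof (rule disc_holomorphicD[OF f V(1)])
    show "(\<lambda>t. coord_update i (\<phi> t) \<zeta> $ k) holomorphic_on V" for k
      using V(2) by (cases "k = i") auto
  qed (use V(3) sub in blast)
qed

lemma cell_dist:
  assumes "d > 0" "\<zeta> \<in> cell d c" "\<xi> \<in> cell d c"
  shows "cmod (\<zeta> - \<xi>) \<le> 2 * d"
proof -
  have "\<bar>Re (\<zeta> - \<xi>)\<bar> \<le> d" "\<bar>Im (\<zeta> - \<xi>)\<bar> \<le> d"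
    using assms by (auto simp: mem_cell algebra_simps abs_if)
  then show ?thesis using cmod_le[of "\<zeta> - \<xi>"] by linarith
qed

text \<open>
One mesh size \<open>d\<close> works for all lines, and one finite set of cells works for all lines near a given
one. For the avoidance of \<open>K\<close>: the part of \<open>K\<close> lying over cells outside \<open>S\<close> is compact and does not
meet the line through \<open>z0\<close>, hence it has positive distance from it. For the inclusion in \<open>\<Omega>\<close>: two layers of
cells stay within \<open>4 * d\<close> of the slice of \<open>K\<close>, which is small compared with the distance from \<open>K\<close> to
the complement of \<open>\<Omega>\<close>.
\<close>

lemma grid_around_slices:
  fixes K \<Omega> :: "(complex ^ 'n) set"
  assumes K: "compact K" and \<Omega>: "open \<Omega>" "K \<subseteq> \<Omega>"
  shows "\<exists>d>0. \<forall>z0. \<exists>S. finite S \<and> (\<exists>\<epsilon>>0. \<forall>z\<in>ball z0 \<epsilon>.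
           (\<forall>c. c \<notin> S \<longrightarrow> cell d c \<inter> slice i K z = {}) \<and>
           cells d (neighbours d S) \<subseteq> slice i \<Omega> z)"
proof -
  have "K \<inter> - \<Omega> = {}" using \<Omega>(2) by blast
  from separate_compact_closed[OF K closed_Compl[OF \<Omega>(1)] this]
  obtain r where r: "r > 0" "\<forall>x\<in>K. \<forall>y\<in>- \<Omega>. r \<le> dist x y" by blast
  \<comment> \<open>two layers of cells reach at most \<open>4 * d\<close>, and moving to a nearby line at most another \<open>d\<close>\<close>
  define d where "d = r / 8"
  have d: "d > 0" using r(1) by (simp add: d_def)
  have "\<exists>S. finite S \<and> (\<exists>\<epsilon>>0. \<forall>z\<in>ball z0 \<epsilon>.
           (\<forall>c. c \<notin> S \<longrightarrow> cell d c \<inter> slice i K z = {}) \<and>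
           cells d (neighbours d S) \<subseteq> slice i \<Omega> z)" for z0
  proof -
    define S where "S = {c. cell d c \<inter> slice i K z0 \<noteq> {}}"
    have finS: "finite S"
      unfolding S_def using finite_cells_meeting[OF d] bounded_slice compact_imp_bounded[OF K] by blast
    have inside: "cells d (neighbours d S) \<subseteq> slice i \<Omega> z" if z: "dist z z0 < d" for z
    proof
      fix \<zeta> assume "\<zeta> \<in> cells d (neighbours d S)"
      then obtain c' \<eta> where \<eta>: "\<zeta> \<in> cell d c'" "\<eta> \<in> cell d c'" "\<eta> \<in> cells d S"
        unfolding cells_def neighbours_def by blast
      then obtain c \<xi> where \<xi>: "\<eta> \<in> cell d c" "\<xi> \<in> cell d c" "\<xi> \<in> slice i K z0"
        unfolding cells_def S_def by blast
      have "cmod (\<zeta> - \<xi>) \<le> 4 * d"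
        using cell_dist[OF d \<eta>(1,2)] cell_dist[OF d \<xi>(1,2)] norm_triangle_ineq[of "\<zeta> - \<eta>" "\<eta> - \<xi>"] by simp
      then have "dist (coord_update i z0 \<xi>) (coord_update i z \<zeta>) < r"
        using dist_coord_update_le[of i z \<zeta> z0 \<xi>] z d by (simp add: dist_commute d_def)
      moreover have "coord_update i z0 \<xi> \<in> K" using \<xi>(3) by (simp add: slice_def)
      ultimately have "coord_update i z \<zeta> \<notin> - \<Omega>" using r(2) by (meson not_le)
      then show "\<zeta> \<in> slice i \<Omega> z" by (simp add: slice_def)
    qed
    \<comment> \<open>the part of \<open>K\<close> over cells outside \<open>S\<close>; it is projected along direction \<open>i\<close>\<close>
    define K' where "K' = K \<inter> (\<lambda>w. w $ i) -` cells d (- S)"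
    have "compact K'"
      unfolding K'_def using closed_cells[OF d]
      by (intro compact_Int_closed K closed_vimage) (auto intro!: continuous_intros)
    then have cK': "compact ((\<lambda>w. coord_update i w 0) ` K')"
      by (intro compact_continuous_image continuous_on_coord_update) (auto intro!: continuous_intros)
    have z0: "coord_update i z0 0 \<notin> (\<lambda>w. coord_update i w 0) ` K'"
    proof
      assume "coord_update i z0 0 \<in> (\<lambda>w. coord_update i w 0) ` K'"
      then obtain w where w: "w \<in> K'" "coord_update i z0 0 = coord_update i w 0" by auto
      have "coord_update i z0 (w $ i) $ k = w $ k" for k
        using arg_cong[OF w(2), of "\<lambda>v. v $ k"] by (auto split: if_splits)
      then have "coord_update i z0 (w $ i) = w" unfolding vec_eq_iff by blast
      then have "w $ i \<in> slice i K z0" using w(1) by (simp add: slice_def K'_def)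
      moreover obtain c where "c \<notin> S" "w $ i \<in> cell d c"
        using w(1) unfolding K'_def cells_def by blast
      ultimately show False unfolding S_def by blast
    qed
    have "{coord_update i z0 0} \<inter> (\<lambda>w. coord_update i w 0) ` K' = {}" using z0 by simp
    from separate_compact_closed[OF compact_sing compact_imp_closed[OF cK'] this]
    obtain e where e: "e > 0"
      "\<forall>x\<in>{coord_update i z0 0}. \<forall>y\<in>(\<lambda>w. coord_update i w 0) ` K'. e \<le> dist x y" by (elim exE conjE)
    have outside: "cell d c \<inter> slice i K z = {}" if "c \<notin> S" "dist z0 z < e" for c z
    proof (rule ccontr)
      assume "cell d c \<inter> slice i K z \<noteq> {}"
      then obtain \<zeta> where \<zeta>: "\<zeta> \<in> cell d c" "coord_update i z \<zeta> \<in> K" by (auto simp: slice_def)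
      then have "\<zeta> \<in> cells d (- S)" unfolding cells_def using \<zeta>(1) that(1) by blast
      then have "coord_update i z \<zeta> \<in> K'" using \<zeta>(2) by (simp add: K'_def)
      then have "e \<le> dist (coord_update i z0 0) (coord_update i (coord_update i z \<zeta>) 0)"
        using e(2) by simp
      also have "coord_update i (coord_update i z \<zeta>) 0 = coord_update i z 0" by (simp add: vec_eq_iff)
      also have "dist (coord_update i z0 0) (coord_update i z 0) \<le> dist z0 z"
        using dist_coord_update_le[of i z0 0 z 0] by simp
      finally show False using that(2) by simp
    qed
    show ?thesis
    proof (intro exI[of _ S] conjI finS exI[of _ "min e d"] ballI allI impI)
      show "min e d > 0" using d e(1) by simp
      fix z assume z: "z \<in> ball z0 (min e d)"
      show "cell d c \<inter> slice i K z = {}" if "c \<notin> S" for c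
        using outside that z by simp
      show "cells d (neighbours d S) \<subseteq> slice i \<Omega> z"
        using inside z by (simp add: dist_commute)
    qed
  qed
  then show ?thesis by (intro exI[of _ d] conjI d allI)
qed

lemma disc_holomorphic_cauchy_grid:
  fixes f :: "complex ^ 'n \<Rightarrow> complex"
  assumes f: "disc_holomorphic f D" and "d > 0" "finite S"
    and sub: "\<And>z. z \<in> W \<Longrightarrow> cells d S \<inter> cells d (- S) \<subseteq> slice i D z"
    and off: "\<And>z. z \<in> W \<Longrightarrow> z $ i \<notin> cells d S \<inter> cells d (- S)"
  shows "disc_holomorphic (\<lambda>z. cauchy_grid d S (\<lambda>\<zeta>. f (coord_update i z \<zeta>)) (z $ i)) W"
proof -
  have "disc_holomorphic (\<lambda>z. boundary_integral d S (\<lambda>\<zeta>. f (coord_update i z \<zeta>) / (\<zeta> - z $ i))) W"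
  proof (rule boundary_integral_closure[where P = "\<lambda>h. disc_holomorphic h W", OF assms(2,3)])
    fix p q assume pq: "closed_segment p q \<subseteq> cells d S \<inter> cells d (- S)"
    have "continuous_on (W \<times> closed_segment p q) (\<lambda>x. f (coord_update i (fst x) (snd x)))"
      by (rule continuous_on_compose2[OF disc_holomorphic_imp_continuous_on[OF f]])
         (use sub pq in \<open>force intro!: continuous_on_coord_update continuous_intros simp: slice_def\<close>)+
    moreover have "snd x - fst x $ i \<noteq> 0" if "x \<in> W \<times> closed_segment p q" for x
    proof
      assume "snd x - fst x $ i = 0"
      then have "fst x $ i \<in> closed_segment p q" using that by (metis eq_iff_diff_eq_0 mem_Times_iff)
      then show False using off[of "fst x"] that pq by (auto simp: mem_Times_iff)
    qed
    ultimately have "continuous_on (W \<times> closed_segment p q) (\<lambda>(z, \<zeta>). f (coord_update i z \<zeta>) / (\<zeta> - z $ i))"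
      unfolding split_beta by (intro continuous_intros) auto
    then show "disc_holomorphic (\<lambda>z. contour_integral (linepath p q) (\<lambda>\<zeta>. f (coord_update i z \<zeta>) / (\<zeta> - z $ i))) W"
    proof (rule disc_holomorphic_linepath_param)
      fix \<zeta> assume \<zeta>: "\<zeta> \<in> closed_segment p q"
      show "disc_holomorphic (\<lambda>z. f (coord_update i z \<zeta>) / (\<zeta> - z $ i)) W"
      proof (intro disc_holomorphic_divide disc_holomorphic_diff disc_holomorphic_const
          disc_holomorphic_component disc_holomorphic_coord_update[OF f])
        show "coord_update i z \<zeta> \<in> D" if "z \<in> W" for z
          using sub[OF that] \<zeta> pq by (auto simp: slice_def)
        show "\<zeta> - z $ i \<noteq> 0" if "z \<in> W" for z
          using off[OF that] \<zeta> pq by auto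
      qed
    qed
  qed (auto intro: disc_holomorphic_const disc_holomorphic_add disc_holomorphic_diff)
  from disc_holomorphic_mult[OF this disc_holomorphic_const[of "1 / (2 * pi * \<i>)"]]
  show ?thesis unfolding cauchy_grid_def by simp
qed

text \<open>
The extension takes at \<open>z\<close> the value of the regular part of the Laurent splitting of \<open>f\<close> on the line
through \<open>z\<close> in direction \<open>i\<close>. The second direction \<open>j\<close> only serves to find lines that miss \<open>K\<close>.
\<close>

theorem hartogs_extension:
  fixes \<Omega> K :: "(complex ^ 'n) set"
  assumes n: "CARD('n) \<ge> 2" and \<Omega>: "open \<Omega>" and K: "compact K" "K \<subseteq> \<Omega>" and conn: "connected (\<Omega> - K)"
    and f: "disc_holomorphic f (\<Omega> - K)"
  shows "\<exists>g. disc_holomorphic g \<Omega> \<and> (\<forall>z\<in>\<Omega> - K. g z = f z)"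
proof (cases "K = {}")
  case True
  then show ?thesis using f by auto
next
  case False
  have "\<exists>i j :: 'n. i \<noteq> j"
  proof (rule ccontr)
    assume "\<not> (\<exists>i j :: 'n. i \<noteq> j)"
    then have "(UNIV :: 'n set) \<subseteq> {undefined}" by auto
    then have "CARD('n) \<le> 1" using card_mono[of "{undefined :: 'n}" UNIV] by simp
    then show False using n by simp
  qed
  then obtain i j :: 'n where ij: "i \<noteq> j" by blast
  have opD: "open (\<Omega> - K)" using \<Omega> K(1) by (auto intro: open_Diff compact_imp_closed)
  define F where "F = (\<lambda>z \<zeta>. f (coord_update i z \<zeta>))"
  have F: "F z holomorphic_on slice i \<Omega> z - slice i K z" for z
    using disc_holomorphic_slice[OF f opD] by (simp add: F_def slice_Diff)
  have clK: "closed (slice i K z)" and bdK: "bounded (slice i K z)" for z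
    using closed_slice[OF compact_imp_closed[OF K(1)]] bounded_slice[OF compact_imp_bounded[OF K(1)]] by auto
  obtain d where d: "d > 0" and grid: "\<forall>z0. \<exists>S. finite S \<and> (\<exists>\<epsilon>>0. \<forall>z\<in>ball z0 \<epsilon>.
           (\<forall>c. c \<notin> S \<longrightarrow> cell d c \<inter> slice i K z = {}) \<and>
           cells d (neighbours d S) \<subseteq> slice i \<Omega> z)"
    using grid_around_slices[OF K(1) \<Omega> K(2), of i] by (elim exE conjE)
  \<comment> \<open>by uniqueness the value of \<open>g\<close> can be computed from any choice of cells\<close>
  define splits where "splits = (\<lambda>z f1. \<exists>f2. laurent_splitting (slice i \<Omega> z) (slice i K z) (F z) f1 f2)"
  define g where "g = (\<lambda>z. (SOME f1. splits z f1) (z $ i))"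
  have g_eq: "g z = f1 (z $ i)" if sp: "splits z f1" and "z \<in> \<Omega>" for z f1
  proof -
    have "splits z (SOME f1. splits z f1)" by (rule someI[of "splits z", OF that(1)])
    then obtain f2 where "laurent_splitting (slice i \<Omega> z) (slice i K z) (F z) (SOME f1. splits z f1) f2"
      unfolding splits_def by (rule exE)
    moreover obtain g2 where "laurent_splitting (slice i \<Omega> z) (slice i K z) (F z) f1 g2"
      using sp unfolding splits_def by (rule exE)
    ultimately show ?thesis
      unfolding g_def
      by (rule laurent_splitting_unique[OF _ _ open_slice[OF \<Omega>] clK bdK slice_mono[OF K(2)]])
         (use that(2) in simp)
  qed
  have "disc_holomorphic g \<Omega>"
  proof (rule disc_holomorphic_locally)
    fix z0 assume "z0 \<in> \<Omega>"
    from grid[rule_format, of z0] obtain S \<epsilon> where S: "finite S" and \<epsilon>: "\<epsilon> > 0"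
      and grid': "\<forall>z\<in>ball z0 \<epsilon>. (\<forall>c. c \<notin> S \<longrightarrow> cell d c \<inter> slice i K z = {}) \<and>
           cells d (neighbours d S) \<subseteq> slice i \<Omega> z"
      by (elim exE conjE)
    have S_out: "\<And>z c. z \<in> ball z0 \<epsilon> \<Longrightarrow> c \<notin> S \<Longrightarrow> cell d c \<inter> slice i K z = {}"
      and S_in: "\<And>z. z \<in> ball z0 \<epsilon> \<Longrightarrow> cells d (neighbours d S) \<subseteq> slice i \<Omega> z"
      using grid' by blast+
    define S' where "S' = (neighbours d S)"
    have S': "finite S'" unfolding S'_def by (rule finite_neighbours[OF d S])
    have SS': "S \<subseteq> S'" unfolding S'_def by (rule subset_neighbours[OF d])
    define f1 where "f1 = (\<lambda>z w. if w \<in> cells d S then cauchy_grid d S' (F z) w else F z w + cauchy_grid d S (F z) w)"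
    define N where "N = ball z0 \<epsilon> \<inter> \<Omega>"
    have split: "splits z (f1 z)"
      and f1': "\<And>w. w \<notin> cells d (- S') \<Longrightarrow> f1 z w = cauchy_grid d S' (F z) w" if "z \<in> N" for z
    proof -
      have z: "z \<in> ball z0 \<epsilon>" using that by (simp add: N_def)
      note grid_z = laurent_splitting_grid[OF d open_slice[OF \<Omega>] clK F S S_out[OF z] S_in[OF z]]
      show "splits z (f1 z)" unfolding splits_def f1_def S'_def by (rule grid_z(1))
      show "\<And>w. w \<notin> cells d (- S') \<Longrightarrow> f1 z w = cauchy_grid d S' (F z) w"
        unfolding f1_def S'_def by (rule grid_z(2))
    qed
    have bd: "cells d A \<inter> cells d (- A) \<subseteq> slice i (\<Omega> - K) z" if "z \<in> N" "S \<subseteq> A" "A \<subseteq> S'" for z A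
    proof -
      have "cells d A \<subseteq> slice i \<Omega> z" using S_in[of z] that cells_mono[OF that(3), of d] by (auto simp: N_def S'_def)
      moreover have "cells d (- A) \<inter> slice i K z = {}" 
      proof (rule ccontr)
        assume "cells d (- A) \<inter> slice i K z \<noteq> {}"
        then obtain c where "c \<notin> A" "cell d c \<inter> slice i K z \<noteq> {}" unfolding cells_def by blast
        then show False using S_out[of z c] that(1,2) by (auto simp: N_def)
      qed
      ultimately show ?thesis by (auto simp: slice_Diff)
    qed
    \<comment> \<open>on \<open>N1\<close> the regular part is an integral over a fixed contour, on \<open>N2\<close> it is \<open>f\<close> plus one\<close>
    define N1 where "N1 = N \<inter> {z. z $ i \<notin> cells d (- S')}"
    define N2 where "N2 = N \<inter> {z. z $ i \<notin> cells d S}"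
    have op: "open (N \<inter> {z. z $ i \<notin> cells d A})" for A
    proof -
      have "open ((\<lambda>z. z $ i) -` (- cells d A) :: (complex ^ 'n) set)"
        using closed_cells[OF d] by (intro open_vimage) (auto intro!: continuous_intros)
      then show ?thesis using \<Omega> by (simp add: N_def vimage_def open_Int)
    qed
    have "disc_holomorphic g N1"
    proof (rule disc_holomorphic_cong)
      show "disc_holomorphic (\<lambda>z. cauchy_grid d S' (\<lambda>\<zeta>. f (coord_update i z \<zeta>)) (z $ i)) N1"
        by (rule disc_holomorphic_cauchy_grid[OF f d S' bd]) (use SS' in \<open>auto simp: N1_def\<close>)
      show "g z = cauchy_grid d S' (\<lambda>\<zeta>. f (coord_update i z \<zeta>)) (z $ i)" if "z \<in> N1" for z
        using that g_eq[OF split] f1' by (auto simp: N1_def N_def F_def)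
    qed
    moreover have "disc_holomorphic g N2"
    proof (rule disc_holomorphic_cong)
      have "N2 \<subseteq> \<Omega> - K"
      proof
        fix z assume z: "z \<in> N2"
        have "z \<notin> K"
        proof
          assume "z \<in> K"
          obtain c where c: "z $ i \<in> cell d c" using mem_cell_floor[OF d] by blast
          then have "c \<notin> S" using z by (auto simp: N2_def cells_def)
          then have "cell d c \<inter> slice i K z = {}" using S_out z by (simp add: N2_def N_def)
          then show False using c \<open>z \<in> K\<close> component_in_slice_iff by blast
        qed
        then show "z \<in> \<Omega> - K" using z by (simp add: N2_def N_def)
      qed
      then have "disc_holomorphic f N2" by (rule disc_holomorphic_subset[OF f])
      moreover have "disc_holomorphic (\<lambda>z. cauchy_grid d S (\<lambda>\<zeta>. f (coord_update i z \<zeta>)) (z $ i)) N2"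
        by (rule disc_holomorphic_cauchy_grid[OF f d S bd]) (use SS' in \<open>auto simp: N2_def\<close>)
      ultimately show "disc_holomorphic (\<lambda>z. f z + cauchy_grid d S (\<lambda>\<zeta>. f (coord_update i z \<zeta>)) (z $ i)) N2"
        by (rule disc_holomorphic_add)
      show "g z = f z + cauchy_grid d S (\<lambda>\<zeta>. f (coord_update i z \<zeta>)) (z $ i)" if "z \<in> N2" for z
      proof -
        have z: "z \<in> N" "z \<in> \<Omega>" "z $ i \<notin> cells d S" using that by (simp_all add: N2_def N_def)
        have "g z = f1 z (z $ i)" by (rule g_eq[OF split[OF z(1)] z(2)])
        also have "\<dots> = F z (z $ i) + cauchy_grid d S (F z) (z $ i)" using z(3) by (simp add: f1_def)
        finally show ?thesis by (simp add: F_def)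
      qed
    qed
    ultimately have "disc_holomorphic g (N1 \<union> N2)"
      unfolding N1_def N2_def by (intro disc_holomorphic_Un_open op)
    moreover have "N1 \<union> N2 = N" 
      using cells_disjoint_outside_neighbours[of d S] unfolding N1_def N2_def S'_def by blast
    ultimately show "\<exists>N. open N \<and> z0 \<in> N \<and> disc_holomorphic g (N \<inter> \<Omega>)"
      using \<epsilon> unfolding N_def by (intro exI[of _ "ball z0 \<epsilon>"]) auto
  qed
  moreover have "g z = f z" if "z \<in> \<Omega> - K" for z
  proof -
    have "continuous_on K (\<lambda>w. Re (w $ j))" by (intro continuous_intros)
    from continuous_attains_sup[OF K(1) False this]
    obtain p where p: "p \<in> K" "\<And>w. w \<in> K \<Longrightarrow> Re (w $ j) \<le> Re (p $ j)"
      by blast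
    obtain r where r: "r > 0" "ball p r \<subseteq> \<Omega>" using \<Omega> K(2) p(1) open_contains_ball by blast
    \<comment> \<open>a line in direction \<open>i\<close> through a point of \<open>A\<close> has \<open>j\<close>-th coordinate too large to meet \<open>K\<close>\<close>
    define A where "A = ball p r \<inter> {w. Re (p $ j) < Re (w $ j)}"
    have "open A" unfolding A_def by (intro open_Int open_ball open_Collect_less) (auto intro!: continuous_intros)
    moreover have "A \<subseteq> \<Omega> - K" using r(2) p(2) by (fastforce simp: A_def)
    moreover have "coord_update j p (p $ j + of_real (r / 2)) \<in> A"
      using dist_coord_update_le[of j p "p $ j" p "p $ j + of_real (r / 2)"] r(1) by (simp add: A_def)
    moreover have "g w - f w = 0" if w: "w \<in> A" for w
    proof -
      have "slice i K w = {}" using p(2) w ij unfolding slice_def A_def by fastforce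
      then have "splits w (F w)"
        unfolding splits_def laurent_splitting_def using F[of w] by (intro exI[of _ "\<lambda>_. 0"]) auto
      then show ?thesis using g_eq[of w "F w"] w r(2) by (auto simp: A_def F_def)
    qed
    ultimately have "g z - f z = 0"
      using disc_holomorphic_identity[of "\<lambda>z. g z - f z" "\<Omega> - K" A z] opD conn that
        disc_holomorphic_diff[OF disc_holomorphic_subset[OF \<open>disc_holomorphic g \<Omega>\<close>, of "\<Omega> - K"] f]
      by blast
    then show ?thesis by simp
  qed
  ultimately show ?thesis by blast
qed

section \<open>The maximum principle and the Schwarz-Pick estimate along chains\<close>

text \<open>
On a complex line through a point of \<open>K\<close> the modulus is at most \<open>B\<close> on the boundary of the slice of
\<open>K\<close>, since each boundary point is a limit of points of \<open>\<Omega> - K\<close> on the line. The maximum modulus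
principle in one variable carries the bound to the slice itself.
\<close>

lemma disc_holomorphic_bound:
  fixes \<Omega> K :: "(complex ^ 'n) set"
  assumes h: "disc_holomorphic h \<Omega>" and \<Omega>: "open \<Omega>" and K: "compact K" "K \<subseteq> \<Omega>"
    and le: "\<And>z. z \<in> \<Omega> - K \<Longrightarrow> cmod (h z) \<le> B" and z: "z \<in> \<Omega>"
  shows "cmod (h z) \<le> B"
proof (cases "z \<in> K")
  case False
  then show ?thesis using le z by blast
next
  case True
  fix i :: 'n
  define u where "u = (\<lambda>\<zeta>. h (coord_update i z \<zeta>))"
  have hol: "u holomorphic_on slice i \<Omega> z"
    unfolding u_def by (rule disc_holomorphic_slice[OF h \<Omega>])
  have sub: "slice i K z \<subseteq> slice i \<Omega> z" by (rule slice_mono[OF K(2)])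
  have cl: "closed (slice i K z)" by (rule closed_slice[OF compact_imp_closed[OF K(1)]])
  have "cmod (u (z $ i)) \<le> B"
  proof (rule maximum_modulus_frontier[where f = u and S = "slice i K z"])
    show "u holomorphic_on interior (slice i K z)"
      using hol sub interior_subset holomorphic_on_subset by blast
    show "continuous_on (closure (slice i K z)) u"
      using holomorphic_on_imp_continuous_on[OF hol] sub cl continuous_on_subset by auto
    show "bounded (slice i K z)" by (rule bounded_slice[OF compact_imp_bounded[OF K(1)]])
    show "z $ i \<in> slice i K z" using True by simp
    fix w assume w: "w \<in> frontier (slice i K z)"
    show "cmod (u w) \<le> B"
    proof (rule ccontr)
      assume "\<not> cmod (u w) \<le> B"
      have "continuous_on (slice i \<Omega> z) (\<lambda>\<zeta>. cmod (u \<zeta>))"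
        by (intro continuous_intros holomorphic_on_imp_continuous_on hol)
      then have "open (slice i \<Omega> z \<inter> (\<lambda>\<zeta>. cmod (u \<zeta>)) -` {B<..})"
        by (intro continuous_open_preimage open_slice \<Omega> open_greaterThan)
      moreover have "slice i \<Omega> z \<inter> (\<lambda>\<zeta>. cmod (u \<zeta>)) -` {B<..} \<subseteq> slice i K z"
        using le by (fastforce simp: slice_def u_def)
      moreover have "w \<in> slice i \<Omega> z \<inter> (\<lambda>\<zeta>. cmod (u \<zeta>)) -` {B<..}"
        using w \<open>\<not> cmod (u w) \<le> B\<close> sub frontier_subset_closed[OF cl] by auto
      ultimately have "w \<in> interior (slice i K z)" using interiorI by blast
      then show False using w by (simp add: frontier_def)
    qed
  qed
  then show ?thesis by (simp add: u_def)
qed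

lemma artanh_real_le:
  assumes "0 \<le> x" "x \<le> y" "y < (1::real)"
  shows "artanh x \<le> artanh y"
proof -
  have "(1 + x) / (1 - x) \<le> (1 + y) / (1 - y)" using assms by (intro frac_le) auto
  moreover have "0 < (1 + x) / (1 - x)" using assms by simp
  ultimately show ?thesis unfolding artanh_def by simp
qed

lemma artanh_add:
  assumes "0 \<le> x" "x < 1" "0 \<le> y" "y < (1::real)"
  shows "artanh ((x + y) / (1 + x * y)) = artanh x + artanh y"
proof -
  have nz: "1 + x * y > 0" using assms by (simp add: add_pos_nonneg)
  have "(1 + (x + y) / (1 + x * y)) / (1 - (x + y) / (1 + x * y)) = ((1 + x) / (1 - x)) * ((1 + y) / (1 - y))"
  proof -
    have "1 + (x + y) / (1 + x * y) = (1 + x) * (1 + y) / (1 + x * y)"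
      "1 - (x + y) / (1 + x * y) = (1 - x) * (1 - y) / (1 + x * y)"
      using nz by (simp_all add: field_simps)
    then show ?thesis using nz by simp
  qed
  moreover have "ln (((1 + x) / (1 - x)) * ((1 + y) / (1 - y))) = ln ((1 + x) / (1 - x)) + ln ((1 + y) / (1 - y))"
    using assms by (intro ln_mult_pos) auto
  ultimately show ?thesis unfolding artanh_def by (simp add: add_divide_distrib)
qed

lemma tanh_artanh_real:
  assumes "0 \<le> x" "x < (1::real)"
  shows "tanh (artanh x) = x"
proof -
  define e where "e = (1 + x) / (1 - x)"
  have e: "e > 0" using assms by (simp add: e_def)
  have "exp (- 2 * artanh x) = 1 / e"
    using e by (simp add: artanh_def e_def[symmetric] exp_minus field_simps)
  then have "tanh (artanh x) = (1 - 1 / e) / (1 + 1 / e)" by (simp add: tanh_real_altdef)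
  also have "\<dots> = x" using assms by (simp add: e_def field_simps)
  finally show ?thesis .
qed

text \<open>
The triangle inequality for the pseudohyperbolic distance. The square of the distance is \<open>1\<close> minus
\<open>(1 - (cmod c)\<^sup>2) * (1 - (cmod v)\<^sup>2) / (cmod (1 - cnj c * v))\<^sup>2\<close>, and the denominator is largest when
\<open>c\<close> and \<open>v\<close> point in opposite directions.
\<close>

lemma Moebius_function_norm_le:
  assumes "cmod c < 1" "cmod v < 1"
  shows "cmod (Moebius_function 0 c v) \<le> (cmod c + cmod v) / (1 + cmod c * cmod v)"
proof -
  let ?D = "cmod (1 - cnj c * v)" and ?N = "cmod (v - c)" and ?E = "1 + cmod c * cmod v"
  have id: "?D\<^sup>2 - ?N\<^sup>2 = (1 - (cmod c)\<^sup>2) * (1 - (cmod v)\<^sup>2)"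
    by (simp only: cmod_power2) (simp add: algebra_simps power2_eq_square)
  have P: "(1 - (cmod c)\<^sup>2) * (1 - (cmod v)\<^sup>2) \<ge> 0"
    using assms by (intro mult_nonneg_nonneg) (simp_all add: power_le_one abs_square_le_1)
  have DE: "?D \<le> ?E"
    using norm_triangle_ineq4[of 1 "cnj c * v"] by (simp add: norm_mult)
  have "cmod (cnj c * v) < 1"
    using norm_mult_less[of "cnj c" 1 v 1] assms by simp
  then have D: "?D > 0" by auto
  have E: "?E > 0" by (simp add: add_pos_nonneg)
  have "(?N / ?D)\<^sup>2 = 1 - (1 - (cmod c)\<^sup>2) * (1 - (cmod v)\<^sup>2) / ?D\<^sup>2"
    using id D by (simp add: power_divide field_simps)
  also have "\<dots> \<le> 1 - (1 - (cmod c)\<^sup>2) * (1 - (cmod v)\<^sup>2) / ?E\<^sup>2"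
    using P D DE E by (intro diff_mono divide_left_mono power_mono mult_pos_pos) auto
  also have "\<dots> = ((cmod c + cmod v) / ?E)\<^sup>2"
  proof -
    have "?E\<^sup>2 - (1 - (cmod c)\<^sup>2) * (1 - (cmod v)\<^sup>2) = (cmod c + cmod v)\<^sup>2"
      by (simp add: algebra_simps power2_eq_square)
    then show ?thesis using E by (simp add: power_divide field_simps)
  qed
  finally have "?N / ?D \<le> (cmod c + cmod v) / ?E"
    by (rule power2_le_imp_le) (use E in simp)
  then show ?thesis by (simp add: Moebius_function_simple norm_divide)
qed

text \<open>
Moving \<open>a\<close> and \<open>g a\<close> to the origin by automorphisms of the disc reduces this to the Schwarz lemma.
\<close>

lemma schwarz_pick:
  assumes g: "g holomorphic_on ball 0 1" "\<And>\<zeta>. cmod \<zeta> < 1 \<Longrightarrow> cmod (g \<zeta>) < 1"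
    and ab: "cmod a < 1" "cmod b < 1"
  shows "cmod (Moebius_function 0 (g a) (g b)) \<le> cmod (Moebius_function 0 a b)"
proof -
  define h where "h = (\<lambda>\<zeta>. Moebius_function 0 (g a) (g (Moebius_function 0 (- a) \<zeta>)))"
  have M: "cmod (Moebius_function 0 (- a) \<zeta>) < 1" if "cmod \<zeta> < 1" for \<zeta>
    using Moebius_function_norm_lt_1[of "- a" \<zeta> 0] ab(1) that by simp
  have "h holomorphic_on ball 0 1"
  proof -
    have 1: "Moebius_function 0 (- a) holomorphic_on ball 0 1"
      using Moebius_function_holomorphic[of "- a"] ab(1) by simp
    have 2: "g \<circ> Moebius_function 0 (- a) holomorphic_on ball 0 1"
      by (rule holomorphic_on_compose_gen[OF 1 g(1)]) (use M in auto)
    have "Moebius_function 0 (g a) \<circ> (g \<circ> Moebius_function 0 (- a)) holomorphic_on ball 0 1"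
      by (rule holomorphic_on_compose_gen[OF 2 Moebius_function_holomorphic]) (use M g(2) ab(1) in auto)
    then show ?thesis by (simp add: h_def o_def)
  qed
  moreover have "h 0 = 0" by (simp add: h_def Moebius_function_of_zero Moebius_function_eq_zero)
  moreover have "cmod (h \<zeta>) < 1" if "cmod \<zeta> < 1" for \<zeta>
    unfolding h_def using M[OF that] g(2) ab(1) by (intro Moebius_function_norm_lt_1) auto
  moreover have "cmod (Moebius_function 0 a b) < 1" using ab by (rule Moebius_function_norm_lt_1)
  ultimately have "cmod (h (Moebius_function 0 a b)) \<le> cmod (Moebius_function 0 a b)"
    by (rule Schwarz_Lemma(1))
  then show ?thesis
    using ab by (simp add: h_def Moebius_function_compose)
qed

text \<open>
One step along a chain: the hyperbolic distance of the value from the origin grows by at most the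
hyperbolic distance of the two points of the disc.
\<close>

lemma artanh_norm_step:
  assumes g: "g holomorphic_on ball 0 1" "\<And>\<zeta>. cmod \<zeta> < 1 \<Longrightarrow> cmod (g \<zeta>) < 1"
    and ab: "cmod a < 1" "cmod b < 1"
  shows "artanh (cmod (g b)) \<le> artanh (cmod (g a)) + poincare_dist a b"
proof -
  define v where "v = Moebius_function 0 (g a) (g b)"
  define \<rho> where "\<rho> = cmod (Moebius_function 0 a b)"
  have ga: "cmod (g a) < 1" and gb: "cmod (g b) < 1" using g(2) ab by auto
  have \<rho>: "0 \<le> \<rho>" "\<rho> < 1" using ab Moebius_function_norm_lt_1 by (auto simp: \<rho>_def)
  have v: "cmod v \<le> \<rho>" unfolding v_def \<rho>_def by (rule schwarz_pick[OF g ab])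
  have mono: "(x + s) / (1 + x * s) \<le> (x + t) / (1 + x * t)" if "0 \<le> x" "x < 1" "0 \<le> s" "s \<le> t" for x s t :: real
  proof -
    have "0 \<le> (t - s) * (1 - x * x)"
      using that mult_le_one[of x x] by (intro mult_nonneg_nonneg) auto
    moreover have "1 + x * s > 0" "1 + x * t > 0" using that by (auto intro: add_pos_nonneg)
    ultimately show ?thesis by (simp add: divide_simps algebra_simps)
  qed
  have "g b = Moebius_function 0 (- g a) v"
    unfolding v_def using ga gb by (simp add: Moebius_function_compose)
  then have "cmod (g b) \<le> (cmod (g a) + cmod v) / (1 + cmod (g a) * cmod v)"
    using Moebius_function_norm_le[of "- g a" v] ga v \<rho> by simp
  also have "\<dots> \<le> (cmod (g a) + \<rho>) / (1 + cmod (g a) * \<rho>)"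
    using ga v by (intro mono) auto
  finally have "artanh (cmod (g b)) \<le> artanh ((cmod (g a) + \<rho>) / (1 + cmod (g a) * \<rho>))"
  proof (intro artanh_real_le)
    have "0 < (1 - cmod (g a)) * (1 - \<rho>)" using ga \<rho> by simp
    moreover have "0 < 1 + cmod (g a) * \<rho>" using \<rho> by (simp add: add_pos_nonneg)
    ultimately show "(cmod (g a) + \<rho>) / (1 + cmod (g a) * \<rho>) < 1" by (simp add: algebra_simps)
  qed auto
  also have "\<dots> = artanh (cmod (g a)) + artanh \<rho>" using ga \<rho> by (intro artanh_add) auto
  also have "artanh \<rho> = poincare_dist a b"
    by (simp add: \<rho>_def poincare_dist_def Moebius_function_simple norm_divide norm_minus_commute)
  finally show ?thesis .
qed

lemma artanh_norm_le_kobayashi_chain: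
  assumes h: "disc_holomorphic h \<Omega>" "\<And>w. w \<in> \<Omega> \<Longrightarrow> cmod (h w) < 1" "h z = 0"
    and chain: "kobayashi_chain \<Omega> z w m f a b"
  shows "artanh (cmod (h w)) \<le> (\<Sum>j<m. poincare_dist (a j) (b j))"
proof -
  have m: "m \<ge> 1" and f0: "f 0 (a 0) = z" and fw: "f (m - 1) (b (m - 1)) = w"
    and link: "\<And>j. Suc j < m \<Longrightarrow> f j (b j) = f (Suc j) (a (Suc j))"
    and disc: "\<And>j. j < m \<Longrightarrow> analytic_disc_in (f j) \<Omega>"
    and ab: "\<And>j. j < m \<Longrightarrow> cmod (a j) < 1 \<and> cmod (b j) < 1"
    using chain unfolding kobayashi_chain_def by auto
  have step: "artanh (cmod (h (f j (b j)))) \<le> artanh (cmod (h (f j (a j)))) + poincare_dist (a j) (b j)"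
    if j: "j < m" for j
  proof (rule artanh_norm_step)
    show "(\<lambda>\<zeta>. h (f j \<zeta>)) holomorphic_on ball 0 1"
      by (rule disc_holomorphicD[OF h(1) open_ball]) (use disc[OF j] in \<open>auto simp: analytic_disc_in_def\<close>)
    show "cmod (h (f j \<zeta>)) < 1" if "cmod \<zeta> < 1" for \<zeta>
      using disc[OF j] that by (intro h(2)) (auto simp: analytic_disc_in_def)
  qed (use ab[OF j] in auto)
  have "k < m \<Longrightarrow> artanh (cmod (h (f k (b k)))) \<le> (\<Sum>j<Suc k. poincare_dist (a j) (b j))" for k
  proof (induction k)
    case 0
    then show ?case using step[of 0] f0 h(3) by simp
  next
    case (Suc k)
    then show ?case using step[of "Suc k"] link[of k] by simp
  qed
  from this[of "m - 1"] show ?thesis using m fw by simp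
qed

text \<open>
A weak bound suffices: \<open>c * h\<close> satisfies the strict bound for every \<open>c < 1\<close>, and \<open>c\<close> tends to \<open>1\<close>.
\<close>

lemma norm_le_tanh_kobayashi_chain:
  assumes h: "disc_holomorphic h \<Omega>" "\<And>w. w \<in> \<Omega> \<Longrightarrow> cmod (h w) \<le> 1" "h z = 0"
    and chain: "kobayashi_chain \<Omega> z w m f a b"
  shows "cmod (h w) \<le> tanh (\<Sum>j<m. poincare_dist (a j) (b j))"
proof (rule field_le_mult_one_interval)
  fix c :: real assume c: "0 < c" "c < 1"
  have "w \<in> \<Omega>"
    using chain unfolding kobayashi_chain_def analytic_disc_in_def
    by (metis diff_less image_subset_iff le_numeral_extra(4) less_le_trans zero_less_one)
  have lt: "c * cmod (h x) < 1" if "x \<in> \<Omega>" for x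
  proof -
    have "c * cmod (h x) \<le> c * 1" using h(2)[OF that] c by (intro mult_left_mono) auto
    then show ?thesis using c(2) by simp
  qed
  have "artanh (cmod (of_real c * h w)) \<le> (\<Sum>j<m. poincare_dist (a j) (b j))"
    by (rule artanh_norm_le_kobayashi_chain[OF disc_holomorphic_mult[OF disc_holomorphic_const h(1)] _ _ chain])
       (use lt c h(3) in \<open>auto simp: norm_mult\<close>)
  then have "tanh (artanh (c * cmod (h w))) \<le> tanh (\<Sum>j<m. poincare_dist (a j) (b j))"
    using c by (simp add: norm_mult)
  then show "c * cmod (h w) \<le> tanh (\<Sum>j<m. poincare_dist (a j) (b j))"
    using lt[OF \<open>w \<in> \<Omega>\<close>] c by (simp add: tanh_artanh_real)
qed

section \<open>Extended embeddings at boundary points\<close>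

lemma holomorphic_map_imp_continuous_on: "holomorphic_map_on F D \<Longrightarrow> continuous_on D F"
  unfolding holomorphic_map_on_def continuous_on_eq_continuous_within
  using has_derivative_continuous by blast

lemma holomorphic_map_imp_disc_holomorphic:
  fixes F :: "complex ^ 'n \<Rightarrow> complex ^ 'm"
  assumes F: "holomorphic_map_on F D" and D: "open D"
  shows "disc_holomorphic (\<lambda>z. F z $ i) D"
  unfolding disc_holomorphic_def
proof (intro conjI allI impI)
  show "continuous_on D (\<lambda>z. F z $ i)"
    by (intro continuous_on_component holomorphic_map_imp_continuous_on F)
  fix V and \<phi> :: "complex \<Rightarrow> complex ^ 'n"
  assume V: "open V" "\<forall>k. (\<lambda>t. \<phi> t $ k) holomorphic_on V" "\<phi> ` V \<subseteq> D"
  show "(\<lambda>t. F (\<phi> t) $ i) holomorphic_on V"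
    unfolding holomorphic_on_open[OF V(1)]
  proof
    fix t assume t: "t \<in> V"
    then have "\<phi> t \<in> D" using V(3) by blast
    then obtain F' where F': "(F has_derivative F') (at (\<phi> t))" "Vector_Spaces.linear (*s) (*s) F'"
      using F D unfolding holomorphic_map_on_def by (metis at_within_open)
    have "\<exists>v. \<forall>k. ((\<lambda>t. \<phi> t $ k) has_field_derivative v $ k) (at t)"
    proof -
      have "\<forall>k. \<exists>x. ((\<lambda>t. \<phi> t $ k) has_field_derivative x) (at t)"
        using V(2) t unfolding holomorphic_on_open[OF V(1)] by blast
      then obtain w where "\<And>k. ((\<lambda>t. \<phi> t $ k) has_field_derivative w k) (at t)" by metis
      then show ?thesis by (intro exI[of _ "\<chi> k. w k"]) simp
    qed
    then obtain v where v: "\<And>k. ((\<lambda>t. \<phi> t $ k) has_field_derivative v $ k) (at t)" by blast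
    have "(\<phi> has_derivative (\<lambda>s. s *s v)) (at t)"
      unfolding has_derivative_componentwise_within[of \<phi>]
    proof
      fix b :: "complex ^ 'n" assume "b \<in> Basis"
      then obtain k u where b: "b = axis k u" by (auto simp: Basis_vec_def)
      have "((\<lambda>t. \<phi> t $ k) has_derivative (\<lambda>s. s * v $ k)) (at t)"
        using v[of k] by (simp add: has_field_derivative_def mult_commute_abs)
      then show "((\<lambda>x. \<phi> x \<bullet> b) has_derivative (\<lambda>x. (x *s v) \<bullet> b)) (at t)"
        unfolding b inner_axis vector_smult_component by (rule has_derivative_inner_left)
    qed
    from has_derivative_compose[OF this F'(1)]
    have "((\<lambda>t. F (\<phi> t)) has_derivative (\<lambda>s. F' (s *s v))) (at t)" .
    from bounded_linear.has_derivative[OF bounded_linear_vec_nth this]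
    have "((\<lambda>t. F (\<phi> t) $ i) has_derivative (\<lambda>s. F' (s *s v) $ i)) (at t)" .
    moreover have "F' (s *s v) $ i = F' v $ i * s" for s
    proof -
      interpret Vector_Spaces.linear "(*s)" "(*s)" F' by (rule F'(2))
      show ?thesis by (simp add: scale)
    qed
    ultimately show "\<exists>x. ((\<lambda>t. F (\<phi> t) $ i) has_field_derivative x) (at t)"
      unfolding has_field_derivative_def by (intro exI[of _ "F' v $ i"]) simp
  qed
qed

lemma norm_sum_cnj_le:
  fixes u v :: "complex ^ 'n"
  shows "cmod (\<Sum>k\<in>UNIV. cnj (u $ k) * v $ k) \<le> norm u * norm v"
proof -
  have "cmod (\<Sum>k\<in>UNIV. cnj (u $ k) * v $ k) \<le> (\<Sum>k\<in>UNIV. \<bar>cmod (u $ k)\<bar> * \<bar>cmod (v $ k)\<bar>)"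
    by (rule order_trans[OF norm_sum]) (simp add: norm_mult)
  also have "\<dots> \<le> norm u * norm v" unfolding norm_vec_def by (rule L2_set_mult_ineq)
  finally show ?thesis .
qed

lemma sum_cnj_self:
  fixes u :: "complex ^ 'n"
  shows "(\<Sum>k\<in>UNIV. cnj (u $ k) * u $ k) = of_real ((norm u)\<^sup>2)"
proof -
  have "(norm u)\<^sup>2 = (\<Sum>k\<in>UNIV. (cmod (u $ k))\<^sup>2)"
    by (simp add: norm_vec_def L2_set_def sum_nonneg)
  then show ?thesis by (simp only: of_real_sum complex_norm_square) (simp add: mult.commute)
qed

text \<open>
If the limit were \<open>F y\<close> with \<open>y \<in> D\<close>, the continuous inverse \<open>G\<close> would make points of \<open>D\<close> that tend
to \<open>x\<close> tend to \<open>y\<close> as well.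
\<close>

lemma embedding_limit_avoids_image:
  fixes F :: "'a::t2_space \<Rightarrow> 'b::topological_space"
  assumes F: "homeomorphism D (F ` D) F G" and x: "x \<in> closure D" "x \<notin> D"
    and lim: "(F \<longlongrightarrow> y) (at x within D)"
  shows "y \<notin> F ` D"
proof
  assume y: "y \<in> F ` D"
  have ev: "\<forall>\<^sub>F w in at x within D. w \<in> D" by (simp add: eventually_at_filter)
  have "((\<lambda>w. G (F w)) \<longlongrightarrow> G y) (at x within D)"
    by (rule continuous_on_tendsto_compose[OF homeomorphism_cont2[OF F] lim y])
       (use ev in eventually_elim, blast)
  moreover have "\<forall>\<^sub>F w in at x within D. G (F w) = w"
    using ev by eventually_elim (rule homeomorphism_apply1[OF F])
  ultimately have lim_id: "((\<lambda>w. w) \<longlongrightarrow> G y) (at x within D)" by (rule Lim_transform_eventually)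
  have "x islimpt D" using x by (simp add: closure_def)
  then have "at x within D \<noteq> bot" by (simp add: trivial_limit_within)
  from tendsto_unique[OF this tendsto_ident_at lim_id] have "x = G y" .
  moreover have "G y \<in> D" using y F by (auto simp: homeomorphism_apply1)
  ultimately show False using x(2) by simp
qed

lemma ball_radius_le_tanh_kobayashi_chain:
  fixes \<Omega> K :: "(complex ^ 'n) set" and F :: "complex ^ 'n \<Rightarrow> complex ^ 'n"
  assumes n: "CARD('n) \<ge> 2" and \<Omega>: "open \<Omega>" and K: "compact K" "K \<subseteq> \<Omega>" "connected (\<Omega> - K)"
    and F: "holomorphic_embedding_on F (\<Omega> - K)" "F ` (\<Omega> - K) \<subseteq> ball 0 1" "F z = 0" and z: "z \<in> \<Omega> - K"
    and r: "r > 0" "ball 0 r \<subseteq> F ` (\<Omega> - K)"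
    and x: "x \<in> frontier (\<Omega> - K) \<inter> K" and chain: "kobayashi_chain \<Omega> z x m f a b"
  shows "r \<le> tanh (\<Sum>j<m. poincare_dist (a j) (b j))"
proof -
  let ?D = "\<Omega> - K"
  have opD: "open ?D" using \<Omega> K(1) by (auto intro: open_Diff compact_imp_closed)
  have hol: "holomorphic_map_on F ?D" and "\<exists>G. homeomorphism ?D (F ` ?D) F G"
    using F(1) by (auto simp: holomorphic_embedding_on_def)
  then obtain G where G: "homeomorphism ?D (F ` ?D) F G" by blast
  have "\<forall>k. \<exists>g. disc_holomorphic g \<Omega> \<and> (\<forall>w\<in>?D. g w = F w $ k)"
    using hartogs_extension[OF n \<Omega> K] holomorphic_map_imp_disc_holomorphic[OF hol opD] by blast
  then obtain g where g: "\<And>k. disc_holomorphic (g k) \<Omega>" "\<And>k w. w \<in> ?D \<Longrightarrow> g k w = F w $ k" by metis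
  define E where "E = (\<lambda>w. \<chi> k. g k w)"
  have E: "E w = F w" if "w \<in> ?D" for w using g(2)[OF that] by (simp add: E_def vec_eq_iff)
  have x': "x \<in> \<Omega>" "x \<in> closure ?D" "x \<notin> ?D" using x K(2) by (auto simp: frontier_def)
  have "continuous_on \<Omega> E"
    unfolding E_def by (intro continuous_on_vec_lambda disc_holomorphic_imp_continuous_on g)
  then have "(E \<longlongrightarrow> E x) (at x)" using \<Omega> x'(1) by (simp add: continuous_on_eq_continuous_at isCont_def)
  then have "(E \<longlongrightarrow> E x) (at x within ?D)" by (rule tendsto_within_subset) simp
  moreover have "\<forall>\<^sub>F w in at x within ?D. E w = F w" using E by (simp add: eventually_at_filter)
  ultimately have "(F \<longlongrightarrow> E x) (at x within ?D)" by (rule Lim_transform_eventually)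
  from embedding_limit_avoids_image[OF G x'(2,3) this] have "E x \<notin> ball 0 r" using r(2) by blast
  then have nr: "r \<le> norm (E x)" by simp
  define u where "u = E x"
  have u: "norm u > 0" using less_le_trans[OF r(1) nr] by (simp only: u_def)
  \<comment> \<open>the component of the extended map along \<open>E x\<close>, which has modulus \<open>norm (E x)\<close> at \<open>x\<close>\<close>
  define h where "h = (\<lambda>w. (\<Sum>k\<in>UNIV. cnj (u $ k) * g k w) * of_real (1 / norm u))"
  have h: "disc_holomorphic h \<Omega>"
    unfolding h_def by (intro disc_holomorphic_mult disc_holomorphic_sum disc_holomorphic_const g(1))
  have hE: "h w = (\<Sum>k\<in>UNIV. cnj (u $ k) * E w $ k) * of_real (1 / norm u)" for w
    by (simp add: h_def E_def)
  have "cmod (h w) \<le> 1" if "w \<in> ?D" for w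
  proof -
    have "norm (E w) \<le> 1" using E[OF that] F(2) that by force
    have "cmod (h w) = cmod (\<Sum>k\<in>UNIV. cnj (u $ k) * E w $ k) / norm u"
      by (simp add: hE norm_mult norm_divide)
    also have "\<dots> \<le> norm u * norm (E w) / norm u"
      using u by (intro divide_right_mono norm_sum_cnj_le) simp
    also have "\<dots> \<le> 1" using u \<open>norm (E w) \<le> 1\<close> by simp
    finally show ?thesis .
  qed
  then have "cmod (h w) \<le> 1" if "w \<in> \<Omega>" for w
    using disc_holomorphic_bound[OF h \<Omega> K(1,2) _ that] by blast
  moreover have "h z = 0" using E[OF z] F(3) by (simp add: hE)
  ultimately have "cmod (h x) \<le> tanh (\<Sum>j<m. poincare_dist (a j) (b j))"
    using norm_le_tanh_kobayashi_chain[OF h _ _ chain] by blast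
  moreover have "h x = of_real (norm u)"
    using u by (simp add: hE u_def[symmetric] sum_cnj_self power2_eq_square)
  ultimately show ?thesis using nr by (simp add: u_def)
qed

section \<open>Bounds for the squeezing function\<close>

text \<open>
The image of \<open>D\<close> is open by invariance of domain, so it contains some ball around \<open>0\<close> and the
supremum defining \<open>squeezing_radius\<close> is over a nonempty set.
\<close>

lemma squeezing_radius_bounds:
  fixes F :: "complex ^ 'n \<Rightarrow> complex ^ 'n"
  assumes D: "open D" "z \<in> D" and F: "holomorphic_embedding_on F D" "F z = 0"
    and le: "\<And>r. r > 0 \<Longrightarrow> ball 0 r \<subseteq> F ` D \<Longrightarrow> r \<le> t"
  shows "0 \<le> squeezing_radius D F" "squeezing_radius D F \<le> t"
proof -
  obtain G where G: "homeomorphism D (F ` D) F G"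
    using F(1) by (auto simp: holomorphic_embedding_on_def)
  have "inj_on F D" using homeomorphism_apply1[OF G] by (rule inj_on_inverseI)
  then have "open (F ` D)" by (rule invariance_of_domain[OF homeomorphism_cont1[OF G] D(1)])
  moreover have "0 \<in> F ` D" using D(2) F(2) by force
  ultimately obtain r where r: "r > 0" "ball 0 r \<subseteq> F ` D" using open_contains_ball by blast
  show "squeezing_radius D F \<le> t"
    unfolding squeezing_radius_def by (rule cSup_least) (use r le in auto)
  have "r \<le> squeezing_radius D F"
    unfolding squeezing_radius_def by (rule cSup_upper) (use r le in \<open>auto simp: bdd_above_def\<close>)
  then show "0 \<le> squeezing_radius D F" using r(1) by simp
qed

text \<open>
Admissible embeddings exist, so the supremum defining \<open>squeezing_function\<close> is over a nonempty set.
\<close>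

lemma affine_embedding_into_ball:
  fixes D :: "(complex ^ 'n) set"
  assumes "bounded D"
  shows "\<exists>F. holomorphic_embedding_on F D \<and> F ` D \<subseteq> ball 0 (1::real) \<and> F z = (0 :: complex ^ 'n)"
proof -
  obtain B where B: "B > 0" "\<And>w. w \<in> D \<Longrightarrow> norm w \<le> B" using assms bounded_pos by blast
  define c where "c = 1 / (B + norm z + 1)"
  have c: "c > 0" using B(1) by (simp add: c_def add_pos_nonneg)
  define F where "F = (\<lambda>w. c *\<^sub>R (w - z))"
  have der: "(F has_derivative (\<lambda>h. c *\<^sub>R h)) (at w within D)" for w
    unfolding F_def by (auto intro!: derivative_eq_intros)
  have lin: "Vector_Spaces.linear (*s) (*s) (\<lambda>h :: complex ^ 'n. c *\<^sub>R h)"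
    by unfold_locales (simp_all add: vec_eq_iff algebra_simps)
  have "inj (\<lambda>h :: complex ^ 'n. c *\<^sub>R h)" using c by (simp add: inj_on_def)
  moreover have "homeomorphism D (F ` D) F (\<lambda>w. (1 / c) *\<^sub>R w + z)"
    using c by (auto simp: homeomorphism_def F_def image_image intro!: continuous_intros)
  ultimately have "holomorphic_embedding_on F D"
    unfolding holomorphic_embedding_on_def holomorphic_map_on_def using der lin by blast
  moreover have "F ` D \<subseteq> ball 0 1"
  proof
    fix y assume "y \<in> F ` D"
    then obtain w where w: "w \<in> D" "y = c *\<^sub>R (w - z)" by (auto simp: F_def)
    have "norm (w - z) < B + norm z + 1" using B(2)[OF w(1)] norm_triangle_ineq4[of w z] by linarith
    then have "norm y < 1" using w(2) B(1) by (simp add: c_def divide_simps add_pos_nonneg)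
    then show "y \<in> ball 0 1" by simp
  qed
  moreover have "F z = 0" by (simp add: F_def)
  ultimately show ?thesis by blast
qed

lemma squeezing_function_bounds:
  fixes D :: "(complex ^ 'n) set"
  assumes D: "open D" "bounded D" "z \<in> D"
    and le: "\<And>F r. holomorphic_embedding_on F D \<Longrightarrow> F ` D \<subseteq> ball 0 1 \<Longrightarrow> F z = (0 :: complex ^ 'n)
               \<Longrightarrow> r > 0 \<Longrightarrow> ball 0 r \<subseteq> F ` D \<Longrightarrow> r \<le> t"
  shows "0 \<le> squeezing_function D z" "squeezing_function D z \<le> t"
proof -
  let ?A = "{squeezing_radius D F | F. holomorphic_embedding_on F D \<and> F ` D \<subseteq> ball 0 1 \<and> F z = 0}"
  obtain F :: "complex ^ 'n \<Rightarrow> complex ^ 'n"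
    where F: "holomorphic_embedding_on F D" "F ` D \<subseteq> ball 0 1" "F z = 0"
    using affine_embedding_into_ball[OF D(2)] by blast
  have bd: "0 \<le> s \<and> s \<le> t" if "s \<in> ?A" for s
  proof -
    from that obtain F :: "complex ^ 'n \<Rightarrow> complex ^ 'n"
      where F: "s = squeezing_radius D F" "holomorphic_embedding_on F D" "F ` D \<subseteq> ball 0 1" "F z = 0"
      by blast
    show ?thesis using squeezing_radius_bounds[OF D(1,3) F(2,4) le[OF F(2,3,4)]] F(1) by simp
  qed
  have ne: "squeezing_radius D F \<in> ?A" using F by blast
  have bdd: "bdd_above ?A" unfolding bdd_above_def using bd by blast
  show "squeezing_function D z \<le> t"
    unfolding squeezing_function_def by (rule cSup_least) (use ne bd in blast)+
  have "squeezing_radius D F \<le> squeezing_function D z"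
    unfolding squeezing_function_def by (rule cSup_upper[OF ne bdd])
  then show "0 \<le> squeezing_function D z" using bd[OF ne] by linarith
qed

theorem theorem1p9:
  fixes \<Omega> K :: "(complex ^ 'n) set"
  assumes "CARD('n) \<ge> 2"
    and "open \<Omega>" and "connected \<Omega>" and "\<Omega> \<noteq> {}" and "bounded \<Omega>"
    and "compact K" and "K \<subseteq> \<Omega>"
    and "connected (\<Omega> - K)"
  shows "\<forall>z\<in>\<Omega> - K. ereal (squeezing_function (\<Omega> - K) z)
           \<le> tanh_ereal (kobayashi_setdist \<Omega> z (frontier (\<Omega> - K) \<inter> K))"
proof
  fix z assume z: "z \<in> \<Omega> - K"
  let ?D = "\<Omega> - K" and ?B = "frontier (\<Omega> - K) \<inter> K"
  define s where "s = squeezing_function ?D z"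
  have D: "open ?D" "bounded ?D"
    using assms(2,5,6) by (auto intro: open_Diff compact_imp_closed bounded_subset)
  have r1: "r \<le> 1" if "F ` ?D \<subseteq> ball 0 1" "r > 0" "ball 0 r \<subseteq> F ` ?D"
    for r and F :: "complex ^ 'n \<Rightarrow> complex ^ 'n"
  proof -
    have "ball (0 :: complex ^ 'n) r \<subseteq> ball 0 1" using that(1,3) by (rule order_trans[rotated])
    then show ?thesis using that(2) by (simp add: ball_subset_ball_iff)
  qed
  have s1: "0 \<le> s" "s \<le> 1"
    unfolding s_def by (rule squeezing_function_bounds[OF D z, where t = 1], erule (2) r1)+
  have chain: "s \<le> tanh (\<Sum>j<m. poincare_dist (a j) (b j))"
    if "x \<in> ?B" "kobayashi_chain \<Omega> z x m f a b" for x m f a b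
    unfolding s_def
    by (rule squeezing_function_bounds(2)[OF D z])
       (rule ball_radius_le_tanh_kobayashi_chain[OF assms(1,2,6,7,8) _ _ _ z _ _ that])
  show "ereal (squeezing_function ?D z) \<le> tanh_ereal (kobayashi_setdist \<Omega> z ?B)"
  proof (cases "s < 1")
    case True
    have "ereal (artanh s) \<le> kobayashi_setdist \<Omega> z ?B"
      unfolding kobayashi_setdist_def kobayashi_dist_def
    proof (intro INF_greatest Inf_greatest, clarify)
      fix x m f a b assume x: "x \<in> frontier ?D" "x \<in> K" and c: "kobayashi_chain \<Omega> z x m f a b"
      have "s \<le> tanh (\<Sum>j<m. poincare_dist (a j) (b j))" by (rule chain[OF _ c]) (use x in simp)
      then have "tanh (artanh s) \<le> tanh (\<Sum>j<m. poincare_dist (a j) (b j))"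
        using s1(1) True by (simp add: tanh_artanh_real)
      then show "ereal (artanh s) \<le> ereal (\<Sum>j<m. poincare_dist (a j) (b j))" by simp
    qed
    then have "tanh_ereal (ereal (artanh s)) \<le> tanh_ereal (kobayashi_setdist \<Omega> z ?B)"
      using tanh_real_lt_1[of "artanh s"]
      by (cases "kobayashi_setdist \<Omega> z ?B") (auto simp: tanh_ereal_def one_ereal_def intro: less_imp_le)
    then show ?thesis using s1(1) True by (simp add: tanh_ereal_def tanh_artanh_real s_def)
  next
    case False
    \<comment> \<open>here \<open>s = 1\<close>, which no chain allows, so the distance is infinite\<close>
    have no_chain: "\<not> kobayashi_chain \<Omega> z x m f a b" if "x \<in> ?B" for x m f a b
    proof
      assume "kobayashi_chain \<Omega> z x m f a b"
      from chain[OF that this] show False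
        using False tanh_real_lt_1[of "\<Sum>j<m. poincare_dist (a j) (b j)"] by linarith
    qed
    have "kobayashi_dist \<Omega> z x = \<infinity>" if "x \<in> ?B" for x
      unfolding kobayashi_dist_def using no_chain[OF that] by (simp add: top_ereal_def)
    then have "kobayashi_setdist \<Omega> z ?B = \<infinity>"
      unfolding kobayashi_setdist_def by (cases "?B = {}") (simp_all add: top_ereal_def)
    then show ?thesis using s1(2) by (simp add: tanh_ereal_def s_def one_ereal_def)
  qed
qed

end
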